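(* Let $\mathbf{P}\subset\mathbb{R}^d$ be a nonempty compact set with $\overline{\operatorname{int}\mathbf{P}}=\mathbf{P}$. Let $\Pi\colon\mathbb{R}^d\to\mathbb{R}^{n^2+nm}$, $\theta\mapsto(A(\theta),B(\theta))$, with $A(\theta)\in\mathbb{R}^{n\times n}$ and $B(\theta)\in\mathbb{R}^{n\times m}$, be real analytic. Suppose the ensemble $\{(A(\theta),B(\theta))\;|\;\theta\in\mathbf{P}\}$ is uniformly ensemble controllable. (a) Then $\dim\mathbf{P}\le 2$. (b) Let $\lambda_1(\theta),\ldots,\lambda_n(\theta)$ denote the eigenvalues of $A(\theta)$. Assume that at least one branch $\{\lambda_k(\theta)\;|\;\theta\in\mathbf{P}\}$ of the eigenvalues is contained in a one-dimensional real subspace $S$ of $\mathbb{C}$. Then $\dim\mathbf{P}=1$. (c) If there is at least one eigenvalue $\lambda_k$ such that $\{\lambda_k(\theta)\;|\;\theta\in\mathbf{P}\}\subset\mathbb{R}$, then $\dim\mathbf{P}=1$.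
   Context: Since $\mathbf{P}\subset\mathbb{R}^d$ is nonempty with $\overline{\operatorname{int}\mathbf{P}}=\mathbf{P}$, its dimension is $\dim\mathbf{P}=d$, with $d\ge1$. Eigenvalues are complex eigenvalues listed with multiplicity. The ensemble is uniformly ensemble controllable if for every $x^*\in C(\mathbf{P},\mathbb{R}^n)$ and every $\varepsilon>0$ there exist $T>0$ and a $\theta$-independent input $u$ such that $\sup_{\theta\in\mathbf{P}}\|\varphi(T,\theta,u)-x^*(\theta)\|<\varepsilon$. In continuous time, $u\in L^1([0,T],\mathbb{R}^m)$ and $\varphi(T,\theta,u)=\int_0^Te^{A(\theta)(T-s)}B(\theta)u(s)\,ds$ (the solution at time $T$ of $\dot x=A(\theta)x+B(\theta)u$, $x(0)=0$). In discrete time, $T$ is a positive integer, $u=(u_0,\ldots,u_{T-1})$ is a sequence in $\mathbb{R}^m$ and $\varphi(T,\theta,u)=\sum_{k=0}^{T-1}A(\theta)^kB(\theta)u_{T-1-k}$. The claim is asserted for each of the two notions. *)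

theory Defs
  imports "HOL-Analysis.Analysis" "HOL-Computational_Algebra.Polynomial"
begin

text \<open>
  Near every point \<open>x\<close> the function is the sum of a multivariate power series; the multi-indices are
  the functions \<open>\<alpha> :: 'd \<Rightarrow> nat\<close>, and summation over them is unconditional
  (hence absolute, the codomain being finite-dimensional).
\<close>

definition real_analytic :: "(real ^ 'd \<Rightarrow> 'b::euclidean_space) \<Rightarrow> bool" where
  "real_analytic f \<longleftrightarrow>
     (\<forall>x. \<exists>r>0. \<exists>c :: ('d \<Rightarrow> nat) \<Rightarrow> 'b. \<forall>y\<in>ball x r.
        ((\<lambda>\<alpha>. (\<Prod>i\<in>UNIV. (y $ i - x $ i) ^ \<alpha> i) *\<^sub>R c \<alpha>) has_sum f y) UNIV)"

text \<open>
  The operations \<open>*\<close>, \<open>^\<close> of type \<open>real ^ 'n ^ 'n\<close> are componentwise, so the powers and the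
  exponential of a matrix are built from the matrix product \<open>**\<close>.
\<close>

definition matrix_power :: "real ^ 'n ^ 'n \<Rightarrow> nat \<Rightarrow> real ^ 'n ^ 'n" where
  "matrix_power M k = (((**) M) ^^ k) (mat 1)"

definition matrix_exp :: "real ^ 'n ^ 'n \<Rightarrow> real ^ 'n ^ 'n" where
  "matrix_exp M = (\<Sum>k. (1 / fact k) *\<^sub>R matrix_power M k)"

definition char_poly :: "real ^ 'n ^ 'n \<Rightarrow> complex poly" where
  "char_poly M = det (mat [:0, 1:] - (\<chi> i j. [:complex_of_real (M $ i $ j):]))"

text \<open>
  \<open>lam k \<theta>\<close>, with \<open>k\<close> ranging over the \<open>n\<close>-element type \<open>'n\<close>, lists the complex eigenvalues of
  \<open>A \<theta>\<close> with algebraic multiplicity. The enumeration may be chosen separately for each \<open>\<theta>\<close>;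
  no continuity of the branches \<open>lam k\<close> is required.
\<close>

definition eigenvalue_branches ::
    "(real ^ 'd) set \<Rightarrow> (real ^ 'd \<Rightarrow> real ^ 'n ^ 'n) \<Rightarrow> ('n \<Rightarrow> real ^ 'd \<Rightarrow> complex) \<Rightarrow> bool" where
  "eigenvalue_branches P A lam \<longleftrightarrow>
     (\<forall>\<theta>\<in>P. image_mset (\<lambda>k. lam k \<theta>) (mset_set UNIV) = proots (char_poly (A \<theta>)))"

definition state_cont ::
    "(real ^ 'd \<Rightarrow> real ^ 'n ^ 'n) \<Rightarrow> (real ^ 'd \<Rightarrow> real ^ 'm ^ 'n) \<Rightarrow>
     real \<Rightarrow> real ^ 'd \<Rightarrow> (real \<Rightarrow> real ^ 'm) \<Rightarrow> real ^ 'n" where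
  "state_cont A B T \<theta> u =
     (LINT s:{0..T}|lebesgue. matrix_exp ((T - s) *\<^sub>R A \<theta>) *v (B \<theta> *v u s))"

definition state_disc ::
    "(real ^ 'd \<Rightarrow> real ^ 'n ^ 'n) \<Rightarrow> (real ^ 'd \<Rightarrow> real ^ 'm ^ 'n) \<Rightarrow>
     nat \<Rightarrow> real ^ 'd \<Rightarrow> (nat \<Rightarrow> real ^ 'm) \<Rightarrow> real ^ 'n" where
  "state_disc A B T \<theta> u =
     (\<Sum>k<T. matrix_power (A \<theta>) k *v (B \<theta> *v u (T - 1 - k)))"

text \<open>
  The supremum is taken in \<^typ>\<open>ereal\<close>, where it is meaningful without a boundedness side condition.
  Inputs are total functions, but only their values on \<open>[0, T]\<close>, respectively at \<open>0, \<dots>, T - 1\<close>,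
  enter.
\<close>

definition uniformly_ensemble_controllable_cont ::
    "(real ^ 'd) set \<Rightarrow> (real ^ 'd \<Rightarrow> real ^ 'n ^ 'n) \<Rightarrow> (real ^ 'd \<Rightarrow> real ^ 'm ^ 'n) \<Rightarrow> bool" where
  "uniformly_ensemble_controllable_cont P A B \<longleftrightarrow>
     (\<forall>xstar. continuous_on P xstar \<longrightarrow> (\<forall>\<epsilon>>0. \<exists>T>0. \<exists>u.
        u absolutely_integrable_on {0..T} \<and>
        (SUP \<theta>\<in>P. ereal (norm (state_cont A B T \<theta> u - xstar \<theta>))) < ereal \<epsilon>))"

definition uniformly_ensemble_controllable_disc ::
    "(real ^ 'd) set \<Rightarrow> (real ^ 'd \<Rightarrow> real ^ 'n ^ 'n) \<Rightarrow> (real ^ 'd \<Rightarrow> real ^ 'm ^ 'n) \<Rightarrow> bool" where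
  "uniformly_ensemble_controllable_disc P A B \<longleftrightarrow>
     (\<forall>xstar. continuous_on P xstar \<longrightarrow> (\<forall>\<epsilon>>0. \<exists>T>0. \<exists>u.
        (SUP \<theta>\<in>P. ereal (norm (state_disc A B T \<theta> u - xstar \<theta>))) < ereal \<epsilon>))"

text \<open>
  For the parameter sets considered here every notion of dimension gives \<open>d\<close>; in particular
  the dimension of the affine hull does.
\<close>

lemma aff_dim_eq_CARD_if_regular_closed:
  fixes P :: "(real ^ 'd) set"
  assumes "P \<noteq> {}" and "closure (interior P) = P"
  shows "aff_dim P = int CARD('d)"
proof -
  have "interior P \<noteq> {}"
    using assms by auto
  then show ?thesis
    by (simp add: aff_dim_nonempty_interior)
qed

end

theory Submission
  imports Defs "HOL-Computational_Algebra.Fundamental_Theorem_Algebra"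
begin

text \<open>
  Suppose that infinitely many of the systems share an eigenvalue \<open>z\<close>. A left eigenvector \<open>w \<theta>\<close> of
  \<open>A \<theta>\<close> for \<open>z\<close> turns the state at \<open>\<theta>\<close> into an expression that depends on \<open>\<theta>\<close> only through the
  vector \<open>w \<theta> B(\<theta>)\<close> of \<open>\<complex>\<^sup>m\<close>. Any \<open>m + 1\<close> such vectors are linearly dependent, which yields a nontrivial
  linear relation between the values of a reachable ensemble state at \<open>m + 1\<close> points; continuous targets
  need not satisfy it. Hence every \<open>z\<close> is an eigenvalue of only finitely many \<open>A \<theta>\<close>, and continuous
  eigenvalue branches have finite fibers.

  On some open subset of \<open>P\<close> the eigenvalues are continuous and even differentiable functions. A
  continuous function into a line has an infinite fiber if \<open>d \<ge> 2\<close>, because finite sets do not separate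
  connected open sets. A differentiable function into the plane has an infinite fiber if \<open>d \<ge> 3\<close>: either
  its derivative is surjective somewhere, and Brouwer's theorem gives points of the fiber in
  all nearby slices transversal to a kernel direction, or, by
  Sard's theorem, the image of a planar slice is a null set, and level sets of the first component
  contain nondegenerate continua on which the second component is constant.
\<close>

section \<open>Infinite fibers\<close>

text \<open>In dimension at least two a ball stays connected after removal of finitely many points,
  so every value strictly between two values taken on it has an infinite fiber. If there are no two
  such values, the ball lies in one fiber.\<close>

lemma infinite_fiber_real:
  fixes f :: "'a::euclidean_space \<Rightarrow> real"
  assumes "open V" "V \<noteq> {}" "continuous_on V f" "2 \<le> DIM('a)"
  obtains c where "infinite {x\<in>V. f x = c}"
proof -
  obtain p e where p: "p \<in> V" "e > 0" "ball p e \<subseteq> V"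
    using assms(1,2) openE by (metis all_not_in_conv)
  have inf: "infinite (ball p e)"
    using p(2) finite_imp_not_open[of "ball p e"] by auto
  show thesis
  proof (cases "\<exists>a\<in>ball p e. \<exists>b\<in>ball p e. f a < f b")
    case False
    then have "\<And>x. x \<in> ball p e \<Longrightarrow> f x = f p"
      using p(2) by (metis centre_in_ball linorder_less_linear)
    then have "ball p e \<subseteq> {x\<in>V. f x = f p}"
      using p(3) by auto
    then show thesis
      using inf infinite_super that by blast
  next
    case True
    then obtain a b where ab: "a \<in> ball p e" "b \<in> ball p e" "f a < f b" by blast
    define c where "c = (f a + f b) / 2"
    have c: "f a < c" "c < f b" using ab(3) by (auto simp: c_def)
    have "infinite {x\<in>V. f x = c}"
    proof
      assume "finite {x\<in>V. f x = c}"
      then have "connected (ball p e - {x\<in>V. f x = c})"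
        by (intro connected_open_delete_finite) (use assms in auto)
      then have "connected (f ` (ball p e - {x\<in>V. f x = c}))"
        by (rule connected_continuous_image[rotated])
          (rule continuous_on_subset[OF assms(3)], use p in auto)
      moreover have "f a \<in> f ` (ball p e - {x\<in>V. f x = c})" "f b \<in> f ` (ball p e - {x\<in>V. f x = c})"
        using ab c by auto
      ultimately have "c \<in> f ` (ball p e - {x\<in>V. f x = c})"
        using c connectedD_interval[of _ "f a" "f b" c] by (simp add: less_imp_le)
      then show False using p by auto
    qed
    then show thesis by (rule that)
  qed
qed

text \<open>Differentiability at the single point \<open>p\<close> does not support the implicit
  function theorem; Brouwer's theorem replaces it. Displacements are
  \<open>t *\<^sub>R g + R y\<close> with \<open>g\<close> in the kernel of \<open>D\<close> and
  \<open>R\<close> a right inverse, and each small \<open>t > 0\<close> yields one point of the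
  fiber.\<close>

lemma infinite_fiber_surjective_derivative:
  fixes f :: "'a::euclidean_space \<Rightarrow> 'b::euclidean_space"
  assumes "open V" "p \<in> V" "continuous_on V f" "(f has_derivative D) (at p)" "surj D"
    and dim: "DIM('b) < DIM('a)"
  shows "infinite {x\<in>V. f x = f p}"
proof -
  have lin: "linear D" using assms(4) by (simp add: has_derivative_linear)
  obtain R where R: "linear R" "D \<circ> R = id"
    using linear_surjective_right_inverse[OF lin assms(5)] by blast
  have DR: "D (R y) = y" for y using R(2) by (metis comp_apply id_apply)
  have "\<not> inj D"
    using dim lin by (metis dim_UNIV dim_image_eq dim_subset_UNIV inj_on_subset linorder_not_less span_UNIV subset_UNIV)
  then obtain g where g: "D g = 0" "g \<noteq> 0"
    using lin by (meson linear_injective_0)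
  obtain K where K: "K > 0" "\<And>y. norm (R y) \<le> K * norm y"
    using R(1) linear_bounded_pos by blast
  \<comment> \<open>For \<open>0 < t < r\<close> and \<open>norm y \<le> r\<close> the displacement
    has norm at most \<open>C * r\<close>; the relative error \<open>1 / C\<close> allowed below
    then bounds the first-order remainder by \<open>r\<close>.\<close>
  define C where "C = norm g + K"
  have C: "C > 0" using K(1) by (simp add: C_def add_nonneg_pos)
  obtain d where d: "d > 0" "\<And>y. norm (y - p) < d \<Longrightarrow> norm (f y - f p - D (y - p)) \<le> (1 / C) * norm (y - p)"
    using assms(4) C unfolding has_derivative_at_alt by (meson zero_less_divide_1_iff)
  obtain e where e: "e > 0" "ball p e \<subseteq> V" using assms(1,2) openE by blast
  define r where "r = min d e / (2 * C)"
  have r: "r > 0" "C * r < d" "C * r < e" 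
    using C d(1) e(1) by (auto simp: r_def min_def field_simps)
  have ex: "\<exists>y. norm y \<le> r \<and> p + (t *\<^sub>R g + R y) \<in> V \<and> f (p + (t *\<^sub>R g + R y)) = f p" if t: "t \<in> {0<..<r}" for t
  proof -
    have nb: "norm (t *\<^sub>R g + R y) \<le> C * r" if "norm y \<le> r" for y
    proof -
      have "norm (t *\<^sub>R g + R y) \<le> t * norm g + K * norm y"
        using norm_triangle_ineq[of "t *\<^sub>R g" "R y"] K(2)[of y] t by auto
      also have "\<dots> \<le> r * norm g + K * r"
        using t that K(1) by (intro add_mono mult_mono) auto
      finally show ?thesis by (simp add: C_def algebra_simps)
    qed
    have inV: "p + (t *\<^sub>R g + R y) \<in> V" if "norm y \<le> r" for y
    proof (rule subsetD[OF e(2)])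
      show "p + (t *\<^sub>R g + R y) \<in> ball p e"
        using nb[OF that] r(3) by (subst mem_ball, subst dist_commute) (simp add: dist_norm)
    qed
    \<comment> \<open>Fixed points of \<open>h\<close> are the solutions of \<open>f = f p\<close>
      in the slice. As \<open>D\<close> maps the displacement to \<open>y\<close>, the value
      \<open>h y\<close> is the negative first-order remainder.\<close>
    define h where "h = (\<lambda>y. y - (f (p + (t *\<^sub>R g + R y)) - f p))"
    have "continuous_on (cball 0 r) h"
      unfolding h_def
      by (intro continuous_intros continuous_on_compose2[OF assms(3)] linear_continuous_on_compose[OF _ R(1)])
        (use inV in auto)
    moreover have "h \<in> cball 0 r \<rightarrow> cball 0 r"
    proof
      fix y assume "y \<in> cball (0::'b) r"
      then have y: "norm y \<le> r" by simp
      let ?v = "t *\<^sub>R g + R y"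
      have "D ?v = y"
        using g(1) by (simp add: linear_add[OF lin] linear_scale[OF lin] DR)
      then have "norm (h y) = norm (f (p + ?v) - f p - D ?v)"
        by (simp add: h_def norm_minus_commute algebra_simps)
      also have "\<dots> \<le> (1 / C) * norm ?v"
        using d(2)[of "p + ?v"] nb[OF y] r by simp
      also have "\<dots> \<le> (1 / C) * (C * r)"
        using nb[OF y] C by (intro mult_left_mono) auto
      finally show "h y \<in> cball 0 r" using C by simp
    qed
    ultimately obtain y where "y \<in> cball 0 r" "h y = y"
      using brouwer_ball r(1) by blast
    then show ?thesis using inV by (auto simp: h_def intro!: exI[of _ y])
  qed
  then obtain y where y: "\<And>t. t \<in> {0<..<r} \<Longrightarrow> norm (y t) \<le> r \<and> p + (t *\<^sub>R g + R (y t)) \<in> V \<and> f (p + (t *\<^sub>R g + R (y t))) = f p"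
    by metis
  \<comment> \<open>Applying \<open>D\<close> recovers \<open>y\<close> from the displacement, and
    then \<open>g \<noteq> 0\<close> recovers \<open>t\<close>.\<close>
  have "inj_on (\<lambda>t. p + (t *\<^sub>R g + R (y t))) {0<..<r}"
  proof (rule inj_onI)
    fix s t assume "p + (s *\<^sub>R g + R (y s)) = p + (t *\<^sub>R g + R (y t))"
    then have eq: "s *\<^sub>R g + R (y s) = t *\<^sub>R g + R (y t)" by simp
    then have "D (s *\<^sub>R g + R (y s)) = D (t *\<^sub>R g + R (y t))" by simp
    then have "y s = y t" using g(1) by (simp add: linear_add[OF lin] linear_scale[OF lin] DR)
    with eq g(2) show "s = t" by simp
  qed
  moreover have "infinite {0<..<r}" using r(1) by simp
  ultimately have "infinite ((\<lambda>t. p + (t *\<^sub>R g + R (y t))) ` {0<..<r})"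
    using finite_imageD by blast
  moreover have "(\<lambda>t. p + (t *\<^sub>R g + R (y t))) ` {0<..<r} \<subseteq> {x\<in>V. f x = f p}"
    using y by auto
  ultimately show ?thesis using infinite_super by blast
qed

text \<open>The level sets of the first component separate the plane; by Fubini almost every one of them
  is mapped by the second component onto a null set, so that a separating component of the level
  set is contained in a single fiber.\<close>

lemma infinite_fiber_negligible_image_UNIV:
  fixes f :: "'a::euclidean_space \<Rightarrow> real \<times> real"
  assumes cont: "continuous_on UNIV f" and neg: "negligible (range f)" and dim: "2 \<le> DIM('a)"
  obtains c where "infinite {x. f x = c}"
proof (cases "\<exists>a b. fst (f a) < fst (f b)")
  case False
  then have const: "fst (f x) = fst (f y)" for x y
    by (metis linorder_less_linear)
  obtain c where "infinite {x\<in>UNIV. snd (f x) = c}"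
    by (rule infinite_fiber_real[OF open_UNIV UNIV_not_empty _ dim, of "\<lambda>x. snd (f x)"])
      (intro continuous_intros cont)
  moreover have "{x\<in>UNIV. snd (f x) = c} = {x. f x = (fst (f 0), c)}"
    using const by (auto intro!: prod_eqI)
  ultimately show thesis using that by metis
next
  case True
  then obtain a b where ab: "fst (f a) < fst (f b)" by blast
  define I where "I = range f"
  \<comment> \<open>Sigma-compactness makes the image Borel, so that Tonelli's theorem applies to
    it.\<close>
  have "I = (\<Union>n. f ` cball 0 (real n))"
    unfolding I_def image_UN[symmetric] 
    by (intro arg_cong[of UNIV _ "image f"]) (simp add: set_eq_iff real_arch_simple)
  moreover have "f ` cball 0 (real n) \<in> sets borel" for n
    by (intro borel_compact compact_continuous_image continuous_on_subset[OF cont]) auto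
  ultimately have Ib: "I \<in> sets lborel" by auto
  then have "I \<in> null_sets lborel"
    using neg unfolding I_def[symmetric] negligible_iff_null_sets
    by (auto simp: null_sets_def)
  then have "emeasure (lborel \<Otimes>\<^sub>M lborel) I = 0" 
    by (simp add: lborel_prod null_sets_def)
  moreover have Ip: "I \<in> sets (lborel \<Otimes>\<^sub>M lborel :: (real \<times> real) measure)" using Ib by (simp only: lborel_prod)
  ultimately have "(\<integral>\<^sup>+x. emeasure lborel (Pair x -` I) \<partial>(lborel :: real measure)) = 0"
    using lborel.emeasure_pair_measure_alt[of I lborel] by simp
  then have AE: "AE x in (lborel::real measure). emeasure lborel (Pair x -` I) = 0"
    using lborel.measurable_emeasure_Pair[OF Ip] by (simp add: nn_integral_0_iff_AE)
  \<comment> \<open>The exceptional abscissas form a null set, but the interval has positive length.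
    A level strictly between two attained values makes \<open>L\<close> separate the space.\<close>
  have "\<exists>c. fst (f a) < c \<and> c < fst (f b) \<and> emeasure lborel (Pair c -` I) = 0"
  proof (rule ccontr)
    assume "\<not> ?thesis"
    then have "{fst (f a)<..<fst (f b)} \<subseteq> {x. emeasure lborel (Pair x -` I) \<noteq> 0}" by auto
    then have "AE x in lborel. x \<notin> {fst (f a)<..<fst (f b)}"
      using AE by (auto elim!: eventually_mono)
    then have "emeasure lborel {fst (f a)<..<fst (f b)} = 0"
      by (subst (asm) AE_iff_measurable[where N="{fst (f a)<..<fst (f b)}"]) auto
    then show False using ab by simp
  qed
  then obtain c where c: "fst (f a) < c" "c < fst (f b)" "emeasure lborel (Pair c -` I) = 0" by blast
  define L where "L = {x. fst (f x) = c}"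
  have "closed L" unfolding L_def
    by (intro closed_Collect_eq continuous_intros cont)
  moreover have "\<not> connected (- L)"
  proof
    assume "connected (- L)"
    then have "connected ((\<lambda>x. fst (f x)) ` (- L))"
      by (rule connected_continuous_image[rotated]) (intro continuous_intros continuous_on_subset[OF cont], auto)
    moreover have "fst (f a) \<in> (\<lambda>x. fst (f x)) ` (- L)" "fst (f b) \<in> (\<lambda>x. fst (f x)) ` (- L)"
      using c by (auto simp: L_def)
    ultimately have "c \<in> (\<lambda>x. fst (f x)) ` (- L)"
      using c connectedD_interval[of _ "fst (f a)" "fst (f b)" c] by (simp add: less_imp_le)
    then show False by (auto simp: L_def)
  qed
  ultimately obtain C where C: "C \<in> components L" "\<not> connected (- C)"
    using separation_by_component_closed by blast
  have "infinite C"
  proof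
    assume "finite C"
    then have "connected (UNIV - C)"
      by (intro connected_open_delete_finite) (use dim in auto)
    with C(2) show False by (simp add: Compl_eq_Diff_UNIV)
  qed
  then obtain q where q: "q \<in> C" by (metis ex_in_conv finite.emptyI)
  have CL: "C \<subseteq> L" using C(1) in_components_subset by blast
  have con: "connected ((\<lambda>x. snd (f x)) ` C)"
    using C(1) by (intro connected_continuous_image continuous_intros continuous_on_subset[OF cont])
      (auto simp: in_components_connected)
  have sub: "(\<lambda>x. snd (f x)) ` C \<subseteq> Pair c -` I"
    using CL by (force simp: L_def I_def)
  \<comment> \<open>The image of \<open>C\<close> under the second component is connected; if
    nonconstant, it would put an interval of positive length into a null slice.\<close>
  have eq: "snd (f x) = snd (f y)" if "x \<in> C" "y \<in> C" for x y
  proof (rule ccontr)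
    have less: False if "x \<in> C" "y \<in> C" "snd (f x) < snd (f y)" for x y
    proof -
      have "{snd (f x)<..<snd (f y)} \<subseteq> (\<lambda>x. snd (f x)) ` C"
        using connectedD_interval[OF con, of "snd (f x)" "snd (f y)"] that by auto
      with sub have "{snd (f x)<..<snd (f y)} \<subseteq> Pair c -` I" by blast
      then have "emeasure lborel {snd (f x)<..<snd (f y)} \<le> emeasure lborel (Pair c -` I)"
        using Ip by (intro emeasure_mono sets_Pair1)
      with c(3) that show False by simp
    qed
    assume "snd (f x) \<noteq> snd (f y)"
    then show False using less that by (meson linorder_less_linear)
  qed
  have "C \<subseteq> {x. f x = (c, snd (f q))}"
    using CL eq[OF _ q] by (auto simp: L_def intro!: prod_eqI)
  with \<open>infinite C\<close> show thesis using that infinite_super by blast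
qed

text \<open>A ball is homeomorphic to the whole space, and precomposing with the homeomorphism only
  shrinks the image; the linear injection \<open>L\<close> into pairs preserves null sets.\<close>

lemma infinite_fiber_negligible_image:
  fixes f :: "'a::euclidean_space \<Rightarrow> real ^ 2"
  assumes "open V" "V \<noteq> {}" and cont: "continuous_on V f" and neg: "negligible (f ` V)"
    and dim: "2 \<le> DIM('a)"
  obtains c where "infinite {x\<in>V. f x = c}"
proof -
  obtain p e where p: "e > 0" "ball p e \<subseteq> V"
    using assms(1,2) openE by (metis all_not_in_conv)
  obtain h k where "homeomorphism (ball p e) (UNIV::'a set) h k"
    using homeomorphic_ball_UNIV[OF p(1), of p] unfolding homeomorphic_def by blast
  then have k: "continuous_on UNIV k" "\<And>x. k x \<in> ball p e" "inj k"
    unfolding homeomorphism_def by (auto intro: inj_on_inverseI)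
  define L where "L = (\<lambda>z::real^2. (z $ 1, z $ 2))"
  have L: "linear L" unfolding L_def by (intro linearI) auto
  have injL: "inj L" by (auto simp: inj_def L_def vec_eq_iff forall_2)
  have cont': "continuous_on UNIV (\<lambda>x. L (f (k x)))"
    by (intro linear_continuous_on_compose[OF _ L] continuous_on_compose2[OF cont k(1)]) (use k p in auto)
  have "negligible (L ` (f ` V))"
    by (rule negligible_differentiable_image_negligible[OF _ neg])
      (auto simp: linear_imp_differentiable_on L)
  then have neg': "negligible (range (\<lambda>x. L (f (k x))))"
    by (rule negligible_subset) (use k(2) p(2) in blast)
  obtain c where c: "infinite {x. L (f (k x)) = c}"
    by (rule infinite_fiber_negligible_image_UNIV[OF cont' neg' dim])
  then obtain q where q: "L (f (k q)) = c" by (metis (mono_tags, lifting) empty_Collect_eq finite.emptyI)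
  have "infinite (k ` {x. L (f (k x)) = c})"
    using c k(3) by (meson finite_imageD inj_on_subset subset_UNIV)
  moreover have "k ` {x. L (f (k x)) = c} \<subseteq> {x\<in>V. f x = f (k q)}"
    using k(2) p q injL by (auto simp: inj_def)
  ultimately show thesis using that infinite_super by blast
qed

lemma infinite_fiber_differentiable:
  fixes f :: "real ^ 'd \<Rightarrow> real ^ 2"
  assumes "open V" "V \<noteq> {}" and diff: "\<And>x. x \<in> V \<Longrightarrow> f differentiable (at x)"
    and dim: "3 \<le> CARD('d)"
  obtains c where "infinite {x\<in>V. f x = c}"
proof -
  have cont: "continuous_on V f"
    using diff by (meson continuous_at_imp_continuous_on differentiable_imp_continuous_within)
  obtain D where D: "\<And>x. x \<in> V \<Longrightarrow> (f has_derivative D x) (at x)"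
    using diff unfolding differentiable_def by metis
  show thesis
  proof (cases "\<exists>p\<in>V. surj (D p)")
    case True
    then obtain p where "p \<in> V" "surj (D p)" by blast
    then have "infinite {x\<in>V. f x = f p}"
      using infinite_fiber_surjective_derivative[OF assms(1) _ cont D] dim by simp
    then show thesis by (rule that)
  next
    case False
    obtain p where p: "p \<in> V" using assms(2) by blast
    obtain T where "card T = 2" "T \<subseteq> (UNIV::'d set)"
      using dim obtain_subset_with_card_n[of 2 "UNIV::'d set"] by auto
    then obtain i j :: 'd where ij: "i \<noteq> j" by (auto simp: card_2_iff)
    \<comment> \<open>Sard's theorem for merely differentiable maps needs a source of dimension at
      most that of the target, hence this planar slice through \<open>p\<close>. Along it the
      derivative factors through \<open>D (E x)\<close> and is still not onto.\<close>
    define E where "E = (\<lambda>y::real^2. p + (y $ 1 *\<^sub>R axis i 1 + y $ 2 *\<^sub>R axis j 1))"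
    define E' where "E' = (\<lambda>y::real^2. y $ 1 *\<^sub>R axis i 1 + y $ 2 *\<^sub>R (axis j 1 :: real^'d))"
    have linE': "linear E'" unfolding E'_def by (intro linearI) (auto simp: algebra_simps)
    have EE': "E y = p + E' y" for y by (simp add: E_def E'_def)
    have E'i: "E' y $ i = y $ 1" "E' y $ j = y $ 2" for y using ij by (auto simp: E'_def axis_def)
    have injE: "inj E" 
      by (rule injI) (metis EE' E'i add_left_cancel exhaust_2 vec_eq_iff)
    have dE: "(E has_derivative E') (at y)" for y
      unfolding EE' by (rule derivative_eq_intros linear_imp_has_derivative[OF linE'] refl)+ simp
    have contE: "continuous_on UNIV E"
      using dE by (meson continuous_at_imp_continuous_on has_derivative_continuous)
    define W where "W = E -` V"
    have W: "open W" unfolding W_def using assms(1) contE by (simp add: open_vimage)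
    have "0 \<in> W" using p by (simp add: W_def E_def)
    then have W0: "W \<noteq> {}" by blast
    have dfE: "((\<lambda>y. f (E y)) has_derivative (\<lambda>y. D (E x) (E' y))) (at x)" if "x \<in> W" for x
      using that D[of "E x"] has_derivative_compose[OF dE[of x], of f "D (E x)"] by (auto simp: W_def)
    have "negligible ((\<lambda>y. f (E y)) ` W)"
    proof (rule baby_Sard)
      fix x assume x: "x \<in> W"
      show "((\<lambda>y. f (E y)) has_derivative (\<lambda>y. D (E x) (E' y))) (at x within W)"
        using dfE[OF x] by (rule has_derivative_at_withinI)
      have "linear (\<lambda>y. D (E x) (E' y))" using dfE[OF x] by (rule has_derivative_linear)
      moreover have "\<not> surj (\<lambda>y. D (E x) (E' y))"
        using False x by (auto simp: W_def surj_def) metis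
      ultimately have "rank (matrix (\<lambda>y. D (E x) (E' y))) \<noteq> CARD(2)"
        by (subst full_rank_surjective) (simp add: matrix_works)
      then show "rank (matrix (\<lambda>y. D (E x) (E' y))) < CARD(2)"
        using rank_bound[of "matrix (\<lambda>y. D (E x) (E' y))"] by simp
    qed simp
    moreover have "continuous_on W (\<lambda>y. f (E y))"
      using dfE by (intro continuous_at_imp_continuous_on ballI has_derivative_continuous)
    ultimately obtain c where c: "infinite {x\<in>W. f (E x) = c}"
      using infinite_fiber_negligible_image[OF W W0, of "\<lambda>y. f (E y)"] by auto
    then have "infinite (E ` {x\<in>W. f (E x) = c})"
      using injE by (meson finite_imageD inj_on_subset subset_UNIV)
    moreover have "E ` {x\<in>W. f (E x) = c} \<subseteq> {x\<in>V. f x = c}" by (auto simp: W_def)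
    ultimately show thesis using that infinite_super by blast
  qed
qed

text \<open>Pairing with a spanning vector is a coordinate on the line; it turns functions with
  values in \<open>S\<close> into real functions with the same fibers.\<close>

lemma inj_on_inner_line:
  fixes S :: "'a::euclidean_space set"
  assumes "subspace S" "dim S = 1"
  obtains s where "inj_on (\<lambda>z. z \<bullet> s) S"
proof -
  obtain C where C: "independent C" "S \<subseteq> span C" "card C = dim S"
    using basis_exists by blast
  then obtain s where s: "C = {s}" using assms(2) card_1_singletonE by metis
  then have "s \<noteq> 0" using C(1) by auto
  have "inj_on (\<lambda>z. z \<bullet> s) S"
  proof (rule inj_onI)
    fix x y assume "x \<in> S" "y \<in> S" and eq: "x \<bullet> s = y \<bullet> s"
    then obtain k l where "x = k *\<^sub>R s" "y = l *\<^sub>R s"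
      using C(2) unfolding s span_singleton by blast
    with eq \<open>s \<noteq> 0\<close> show "x = y" by simp
  qed
  then show thesis by (rule that)
qed

section \<open>Roots of families of polynomials\<close>

lemma norm_prod_mset_ge:
  fixes f :: "'a \<Rightarrow> 'b::real_normed_field"
  assumes "\<And>x. x \<in># M \<Longrightarrow> r \<le> norm (f x)" "0 \<le> r"
  shows "r ^ size M \<le> norm (\<Prod>x\<in>#M. f x)"
  using assms(1)
proof (induction M)
  case (add x M)
  then have "r * r ^ size M \<le> norm (f x) * norm (\<Prod>x\<in>#M. f x)"
    using assms(2) by (intro mult_mono) auto
  then show ?case by (simp add: norm_mult)
qed simp

text \<open>For monic \<open>p\<close> the value at \<open>z\<close> is the product of the
  differences of \<open>z\<close> and the roots; if all of these had norm at least \<open>r\<close>,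
  so would the product have norm at least \<open>r ^ degree p\<close>.\<close>

lemma root_near_if_small_value:
  fixes p :: "complex poly"
  assumes "lead_coeff p = 1" "0 < r" "norm (poly p z) < r ^ degree p"
  obtains w where "poly p w = 0" "dist w z < r"
proof -
  have "p \<noteq> 0" using assms(1) by auto
  have dec: "p = (\<Prod>x\<in>#proots p. [:-x, 1:])"
    using complex_poly_decompose_multiset[of p] assms(1) by simp
  then have "poly p z = (\<Prod>x\<in>#proots p. z - x)"
    by (metis (no_types, lifting) diff_conv_add_uminus add.commute poly_prod_mset image_mset.compositionality comp_apply 
      image_mset_cong poly_pCons poly_0 mult_zero_right mult.right_neutral add_0_right)
  moreover have "degree p = size (proots p)"
    by (simp add: size_proots_complex)
  ultimately have "\<exists>x\<in>#proots p. norm (z - x) < r"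
    using assms norm_prod_mset_ge[of "proots p" r "\<lambda>x. z - x"] by force
  then show thesis
    using that \<open>p \<noteq> 0\<close> by (auto simp: dist_norm norm_minus_commute)
qed

lemma isCont_imp_tendsto_nhds: "isCont f a \<Longrightarrow> (f \<longlongrightarrow> f a) (nhds a)"
  by (simp add: isCont_def tendsto_at_iff_tendsto_nhds)

lemma isCont_poly_family:
  fixes q :: "'a::t2_space \<Rightarrow> 'b::real_normed_field poly"
  assumes "\<And>x. degree (q x) \<le> n" "\<And>k. isCont (\<lambda>x. coeff (q x) k) a" "isCont f a"
  shows "isCont (\<lambda>x. poly (q x) (f x)) a"
proof -
  have "poly (q x) w = (\<Sum>k\<le>n. coeff (q x) k * w ^ k)" for x w
    using assms(1)[of x] by (simp add: poly_altdef) (intro sum.mono_neutral_left, auto simp: coeff_eq_0)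
  then show ?thesis using assms(2,3) by (simp add: continuous_intros)
qed

text \<open>A root persists because the value at the fixed number \<open>z\<close> tends to zero as
  \<open>x\<close> tends to \<open>a\<close>.\<close>

lemma eventually_root_near:
  fixes q :: "'a::t2_space \<Rightarrow> complex poly"
  assumes "\<And>x. degree (q x) = n" "\<And>x. lead_coeff (q x) = 1" "\<And>k. isCont (\<lambda>x. coeff (q x) k) a"
    and "poly (q a) z = 0" "0 < r"
  shows "\<forall>\<^sub>F x in nhds a. \<exists>w. poly (q x) w = 0 \<and> dist w z < r"
proof -
  have "isCont (\<lambda>x. norm (poly (q x) z)) a"
    using assms(1,3) by (intro continuous_intros isCont_poly_family[where n=n]) auto
  then have "((\<lambda>x. norm (poly (q x) z)) \<longlongrightarrow> 0) (nhds a)"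
    using assms(4) by (auto dest!: isCont_imp_tendsto_nhds)
  then have "\<forall>\<^sub>F x in nhds a. norm (poly (q x) z) < r ^ n"
    using assms(5) by (intro order_tendstoD) auto
  then show ?thesis
    by (rule eventually_mono) (metis root_near_if_small_value assms(1,2,5))
qed

text \<open>Near a point at which the number of distinct roots is maximal, no root splits, and so the roots
  are continuous functions.\<close>

lemma continuous_root_branches:
  fixes q :: "'a::metric_space \<Rightarrow> complex poly"
  assumes U: "open U" "U \<noteq> {}"
    and deg: "\<And>x. degree (q x) = n" and monic: "\<And>x. lead_coeff (q x) = 1"
    and cont: "\<And>x k. x \<in> U \<Longrightarrow> isCont (\<lambda>x. coeff (q x) k) x"
  obtains V and I :: "complex set" and lam where "open V" "V \<noteq> {}" "V \<subseteq> U" "finite I"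
    "\<And>i. i \<in> I \<Longrightarrow> continuous_on V (lam i)"
    "\<And>x. x \<in> V \<Longrightarrow> {z. poly (q x) z = 0} = (\<lambda>i. lam i x) ` I"
proof -
  define R where "R x = {z. poly (q x) z = 0}" for x
  have qnz: "q x \<noteq> 0" for x using monic[of x] by auto
  have fin: "finite (R x)" for x
    unfolding R_def using qnz by (rule poly_roots_finite)
  have "card (R x) \<le> n" for x
    unfolding R_def using card_poly_roots_bound[OF qnz] deg by simp
  then obtain x0 where x0: "x0 \<in> U" "\<And>x. x \<in> U \<Longrightarrow> card (R x) \<le> card (R x0)"
    using ex_has_greatest_nat[of "\<lambda>x. x \<in> U" _ "\<lambda>x. card (R x)" "Suc n"] U(2)
    unfolding less_Suc_eq_le by blast
  \<comment> \<open>The roots at a point with the maximal number of roots serve as labels of the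
    branches.\<close>
  define I where "I = R x0"
  have finI: "finite I" by (simp add: I_def fin)
  \<comment> \<open>Half the least distance between distinct labels, so that the balls of radius
    \<open>\<epsilon>\<close> around them are disjoint; if there are no two labels, any positive
    number does.\<close>
  obtain \<epsilon> where \<epsilon>: "0 < \<epsilon>" "\<And>i j. i \<in> I \<Longrightarrow> j \<in> I \<Longrightarrow> i \<noteq> j \<Longrightarrow> 2 * \<epsilon> \<le> dist i j"
  proof (cases "\<exists>i\<in>I. \<exists>j\<in>I. i \<noteq> j")
    case False
    then show ?thesis using that[of 1] by auto
  next
    case True
    let ?D = "(\<lambda>(i, j). dist i j) ` {(i, j). i \<in> I \<and> j \<in> I \<and> i \<noteq> j}"
    have f: "finite ?D"
      by (intro finite_imageI finite_subset[OF _ finite_cartesian_product[OF finI finI]]) auto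
    moreover have "?D \<noteq> {}" using True by auto
    ultimately have "0 < Min ?D" by auto
    moreover have "Min ?D \<le> dist i j" if "i \<in> I" "j \<in> I" "i \<noteq> j" for i j
      using f that by (intro Min_le) auto
    ultimately show ?thesis using that[of "Min ?D / 2"] by auto
  qed
  have "\<forall>\<^sub>F x in nhds x0. \<forall>i\<in>I. \<exists>w. poly (q x) w = 0 \<and> dist w i < \<epsilon>"
    using finI eventually_root_near[OF deg monic cont[OF x0(1)] _ \<epsilon>(1)]
    by (intro eventually_ball_finite) (auto simp: I_def R_def)
  then obtain V0 where V0: "open V0" "x0 \<in> V0"
    "\<And>x i. x \<in> V0 \<Longrightarrow> i \<in> I \<Longrightarrow> \<exists>w. poly (q x) w = 0 \<and> dist w i < \<epsilon>"
    unfolding eventually_nhds by metis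
  define V where "V = V0 \<inter> U"
  define lam where "lam i x = (SOME w. poly (q x) w = 0 \<and> dist w i < \<epsilon>)" for i x
  have lam: "poly (q x) (lam i x) = 0" "dist (lam i x) i < \<epsilon>" if "x \<in> V" "i \<in> I" for x i
    using someI_ex[OF V0(3)[of x i]] that by (simp_all add: V_def lam_def)
  have inj: "i = j" if "i \<in> I" "j \<in> I" "dist w i < \<epsilon>" "dist w j < \<epsilon>" for w i j
    using \<epsilon>(2)[OF that(1,2)] dist_triangle2[of i j w] that(3,4) by (auto simp: dist_commute)
  \<comment> \<open>Distinct labels give distinct roots, and maximality at \<open>x0\<close> leaves
    no room for another root.\<close>
  have all: "R x = (\<lambda>i. lam i x) ` I" if x: "x \<in> V" for x
  proof (rule card_seteq[symmetric, OF fin])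
    show "(\<lambda>i. lam i x) ` I \<subseteq> R x" using lam(1)[OF x] by (auto simp: R_def)
    have "inj_on (\<lambda>i. lam i x) I"
    proof (rule inj_onI)
      fix i j assume ij: "i \<in> I" "j \<in> I" "lam i x = lam j x"
      then show "i = j" using inj[OF ij(1,2)] lam(2)[OF x] by metis
    qed
    then have "card ((\<lambda>i. lam i x) ` I) = card (R x0)" by (simp add: card_image I_def)
    then show "card (R x) \<le> card ((\<lambda>i. lam i x) ` I)" using x0(2) x by (simp add: V_def)
  qed
  have unique: "w = lam i x" if w: "x \<in> V" "i \<in> I" "poly (q x) w = 0" "dist w i < \<epsilon>" for w i x
  proof -
    obtain j where j: "j \<in> I" "w = lam j x" using all[OF w(1)] w(3) by (auto simp: R_def)
    then have "i = j" using inj[OF w(2) j(1) w(4)] lam(2)[OF w(1) j(1)] by simp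
    with j(2) show ?thesis by simp
  qed
  have contl: "continuous_on V (lam i)" if i: "i \<in> I" for i
  proof (rule continuous_at_imp_continuous_on, rule ballI)
    fix x1 assume x1: "x1 \<in> V"
    show "isCont (lam i) x1"
      unfolding continuous_at tendsto_at_iff_tendsto_nhds
    proof (rule tendstoI)
      fix e :: real assume e: "0 < e"
      \<comment> \<open>A root within \<open>r\<close> of \<open>lam i x1\<close> stays in the ball
        around \<open>i\<close>, where \<open>lam i x\<close> is the only root.\<close>
      define r where "r = min e (\<epsilon> - dist (lam i x1) i)"
      have r: "0 < r" using e lam(2)[OF x1 i] by (simp add: r_def)
      have "\<forall>\<^sub>F x in nhds x1. \<exists>w. poly (q x) w = 0 \<and> dist w (lam i x1) < r"
        using x1 by (intro eventually_root_near[OF deg monic cont _ r] lam(1) i) (auto simp: V_def)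
      moreover have "\<forall>\<^sub>F x in nhds x1. x \<in> V"
        using x1 V0(1) U(1) by (intro eventually_nhds_in_open) (auto simp: V_def)
      ultimately show "\<forall>\<^sub>F x in nhds x1. dist (lam i x) (lam i x1) < e"
      proof eventually_elim
        case (elim x)
        then obtain w where w: "poly (q x) w = 0" "dist w (lam i x1) < r" by blast
        have "dist w i < \<epsilon>"
          using dist_triangle[of w i "lam i x1"] w(2) by (simp add: r_def)
        then have "w = lam i x" using unique elim w i by blast
        then show ?case using w(2) by (simp add: r_def)
      qed
    qed
  qed
  show thesis
    by (rule that[of V I lam]) (use V0 x0 U finI contl all in \<open>auto simp: V_def R_def\<close>)
qed

text \<open>In \<open>f x * g x = f x * g a + f x * (g x - g a)\<close> the last term is of smaller
  order than \<open>norm (x - a)\<close>: its first factor is at most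
  \<open>K * norm (x - a)\<close>, its second tends to zero. So mere continuity of \<open>g\<close>
  suffices where \<open>f\<close> vanishes.\<close>

lemma has_derivative_mult_zero:
  fixes f g :: "'a::real_normed_vector \<Rightarrow> 'b::real_normed_algebra"
  assumes f: "(f has_derivative f') (at a)" "f a = 0" and g: "isCont g a"
  shows "((\<lambda>x. f x * g x) has_derivative (\<lambda>h. f' h * g a)) (at a)"
proof -
  obtain K where K: "\<forall>\<^sub>F x in at a. norm (f x) \<le> K * norm (x - a)"
  proof -
    obtain B where B: "\<And>h. norm (f' h) \<le> norm h * B"
      using bounded_linear.nonneg_bounded[OF has_derivative_bounded_linear[OF f(1)]] by blast
    obtain d where d: "d > 0" "\<And>y. norm (y - a) < d \<Longrightarrow> norm (f y - f a - f' (y - a)) \<le> 1 * norm (y - a)"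
      using f(1) unfolding has_derivative_at_alt by (meson zero_less_one)
    have "norm (f y) \<le> (1 + B) * norm (y - a)" if "norm (y - a) < d" for y
      using d(2)[OF that] B[of "y - a"] norm_triangle_ineq2[of "f y" "f' (y - a)"] f(2)
      by (simp add: algebra_simps)
    then have "\<forall>\<^sub>F x in at a. norm (f x) \<le> (1 + B) * norm (x - a)"
      unfolding eventually_at dist_norm using d(1) by blast
    then show ?thesis by (rule that)
  qed
  have "((\<lambda>x. f x * (g x - g a)) has_derivative (\<lambda>h. 0)) (at a)"
    unfolding has_derivative_at_within
  proof (intro conjI)
    have lim: "((\<lambda>x. K * norm (g x - g a)) \<longlongrightarrow> K * norm (g a - g a)) (at a)"
      using g by (intro tendsto_intros) (simp add: isCont_def)
    show "((\<lambda>y. (f y * (g y - g a) - f a * (g a - g a) - 0) /\<^sub>R norm (y - a)) \<longlongrightarrow> 0) (at a)"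
    proof (rule Lim_null_comparison)
      show "((\<lambda>x. K * norm (g x - g a)) \<longlongrightarrow> 0) (at a)" using lim by simp
      show "\<forall>\<^sub>F x in at a. norm ((f x * (g x - g a) - f a * (g a - g a) - 0) /\<^sub>R norm (x - a)) \<le> K * norm (g x - g a)"
        using K
      proof eventually_elim
        case (elim x)
        have "norm (f x * (g x - g a)) \<le> norm (f x) * norm (g x - g a)" by (rule norm_mult_ineq)
        also have "\<dots> \<le> K * norm (x - a) * norm (g x - g a)" using elim by (intro mult_right_mono) auto
        finally show ?case
          by (cases "x = a") (simp_all add: f(2) inverse_eq_divide pos_divide_le_eq mult_ac)
      qed
    qed
  qed simp
  from has_derivative_add[OF bounded_linear.has_derivative[OF bounded_linear_mult_left[of "g a"] f(1)] this]
  show ?thesis by (simp add: algebra_simps)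
qed

text \<open>With \<open>H a = [:- lam a, 1:] * Q\<close>, comparing \<open>H a\<close> and
  \<open>H x\<close> at \<open>lam x\<close> expresses \<open>lam x - lam a\<close> by the
  coefficient differences \<open>c k\<close>, divided by \<open>Q\<close> at \<open>lam x\<close>.
  These differences vanish at \<open>a\<close>, so the factors \<open>g k\<close>, which contain
  \<open>lam\<close> itself, only have to be continuous.\<close>

lemma differentiable_simple_root:
  fixes H :: "'a::real_normed_vector \<Rightarrow> complex poly"
  assumes deg: "\<And>x. degree (H x) \<le> n" and diff: "\<And>k. (\<lambda>x. coeff (H x) k) differentiable (at a)"
    and cont: "isCont lam a" and root: "\<forall>\<^sub>F x in nhds a. poly (H x) (lam x) = 0"
    and simple: "poly (pderiv (H a)) (lam a) \<noteq> 0"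
  shows "lam differentiable (at a)"
proof -
  have "poly (H a) (lam a) = 0" using root by (rule eventually_nhds_x_imp_x)
  then obtain Q where Q: "H a = [:- lam a, 1:] * Q" by (auto simp: poly_eq_0_iff_dvd elim: dvdE)
  have Qa: "poly Q (lam a) \<noteq> 0"
    using simple unfolding Q pderiv_mult poly_add poly_mult by (simp add: pderiv_pCons)
  define c where "c k x = coeff (H x) k - coeff (H a) k" for k x
  define g where "g k x = lam x ^ k / poly Q (lam x)" for k x
  have "isCont (g k) a" for k
    unfolding g_def using Qa by (intro continuous_intros cont isCont_o2[OF cont poly_isCont]) 
  moreover have "\<exists>c'. (c k has_derivative c') (at a)" for k
    using diff[of k] unfolding c_def differentiable_def[symmetric] by (intro differentiable_diff) auto
  ultimately have "(\<lambda>x. c k x * g k x) differentiable (at a)" for k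
    using has_derivative_mult_zero[of "c k" _ a "g k"] unfolding differentiable_def by (metis c_def diff_self)
  then have sum: "(\<lambda>x. lam a - (\<Sum>k\<le>n. c k x * g k x)) differentiable (at a)"
    by (intro differentiable_diff differentiable_sum) auto
  have "isCont (\<lambda>x. poly Q (lam x)) a" by (rule isCont_o2[OF cont poly_isCont])
  then have "\<forall>\<^sub>F x in at a. poly Q (lam x) \<noteq> 0"
    using Qa by (simp add: isCont_def tendsto_imp_eventually_ne)
  moreover have "\<forall>\<^sub>F x in at a. poly (H x) (lam x) = 0"
    using root by (simp add: eventually_nhds_conv_at)
  ultimately have ev: "\<forall>\<^sub>F x in at a. lam x = lam a - (\<Sum>k\<le>n. c k x * g k x)"
  proof eventually_elim
    case (elim x)
    have alt: "poly (H y) w = (\<Sum>k\<le>n. coeff (H y) k * w ^ k)" for y w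
      using deg[of y] by (simp add: poly_altdef) (intro sum.mono_neutral_left, auto simp: coeff_eq_0)
    have "(\<Sum>k\<le>n. c k x * g k x) = (\<Sum>k\<le>n. coeff (H x) k * lam x ^ k - coeff (H a) k * lam x ^ k) / poly Q (lam x)"
      by (simp add: c_def g_def sum_divide_distrib left_diff_distrib)
    also have "\<dots> = - poly (H a) (lam x) / poly Q (lam x)"
      using elim(2) by (simp add: sum_subtractf alt[symmetric])
    also have "\<dots> = lam a - lam x"
      using elim(1) by (simp add: Q field_simps)
    finally show ?case by simp
  qed
  have eq: "lam a - (\<Sum>k\<le>n. c k a * g k a) = lam a" by (simp add: c_def)
  obtain D where D: "((\<lambda>x. lam a - (\<Sum>k\<le>n. c k x * g k x)) has_derivative D) (at a)"
    using sum unfolding differentiable_def by blast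
  have "(lam has_derivative D) (at a)"
    by (rule has_derivative_transform_eventually[where g = lam, OF D])
      (use ev eq in \<open>auto elim: eventually_mono\<close>)
  then show ?thesis unfolding differentiable_def by blast
qed

section \<open>Multiplicities of roots under differentiation\<close>

lemma order_eq_Suc_order_pderiv:
  fixes p :: "'a::field_char_0 poly"
  assumes "p \<noteq> 0" "poly p z = 0"
  shows "pderiv p \<noteq> 0" "order z p = Suc (order z (pderiv p))"
proof -
  show "pderiv p \<noteq> 0"
  proof
    assume "pderiv p = 0"
    then obtain c where "p = [:c:]"
      using degree_eq_zeroE pderiv_eq_0_iff by blast
    with assms show False by simp
  qed
  show "order z p = Suc (order z (pderiv p))" using assms by (rule order_pderiv)
qed

text \<open>In characteristic zero each differentiation lowers the multiplicity of a root by exactly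
  one; the induction peels off the innermost derivative.\<close>

lemma poly_higher_pderiv_eq_0:
  fixes p :: "'a::field_char_0 poly"
  assumes "p \<noteq> 0" "j < order z p"
  shows "poly ((pderiv ^^ j) p) z = 0"
  using assms
proof (induction j arbitrary: p)
  case 0
  then show ?case by (simp add: order_root)
next
  case (Suc j)
  then have "poly p z = 0" by (simp add: order_root)
  with Suc show ?case
    using order_eq_Suc_order_pderiv[of p z] by (simp add: funpow_swap1)
qed

lemma poly_order_pderiv_neq_0:
  fixes p :: "'a::field_char_0 poly"
  assumes "p \<noteq> 0"
  shows "poly ((pderiv ^^ order z p) p) z \<noteq> 0"
  using assms
proof (induction "order z p" arbitrary: p)
  case 0
  then show ?case by (metis funpow_0 order_root)
next
  case (Suc j)
  then have "poly p z = 0" by (simp add: order_root)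
  with Suc show ?case
    using order_eq_Suc_order_pderiv[of p z] by (simp add: funpow_swap1)
qed

lemma degree_higher_pderiv_le:
  fixes p :: "'a::field_char_0 poly"
  shows "degree ((pderiv ^^ j) p) \<le> degree p"
proof (induction j)
  case (Suc j)
  then show ?case by (simp add: degree_pderiv)
qed simp

lemma differentiable_coeff_higher_pderiv:
  fixes q :: "'a::real_normed_vector \<Rightarrow> 'b::real_normed_field poly"
  assumes "\<And>k. (\<lambda>x. coeff (q x) k) differentiable (at a)"
  shows "(\<lambda>x. coeff ((pderiv ^^ j) (q x)) k) differentiable (at a)"
proof (induction j arbitrary: k)
  case (Suc j)
  then show ?case by (simp add: coeff_pderiv differentiable_mult)
qed (simp add: assms)

text \<open>Where the multiplicity of the root is minimal it is locally constant, so that the root is a simple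
  root of a suitable derivative of the polynomial.\<close>

lemma differentiable_root_branch:
  fixes q :: "'a::real_normed_vector \<Rightarrow> complex poly"
  assumes U: "open U" "U \<noteq> {}"
    and deg: "\<And>x. degree (q x) \<le> n" and nz: "\<And>x. q x \<noteq> 0"
    and diff: "\<And>x k. x \<in> U \<Longrightarrow> (\<lambda>x. coeff (q x) k) differentiable (at x)"
    and cont: "continuous_on U lam" and root: "\<And>x. x \<in> U \<Longrightarrow> poly (q x) (lam x) = 0"
  obtains W where "open W" "W \<noteq> {}" "W \<subseteq> U" "\<And>x. x \<in> W \<Longrightarrow> lam differentiable (at x)"
proof -
  obtain x1 where x1: "x1 \<in> U" "\<And>x. x \<in> U \<Longrightarrow> order (lam x1) (q x1) \<le> order (lam x) (q x)"
    using ex_has_least_nat[of "\<lambda>x. x \<in> U" _ "\<lambda>x. order (lam x) (q x)"] U(2) by blast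
  have "order (lam x1) (q x1) \<noteq> 0" using root[OF x1(1)] nz order_root by blast
  then obtain m where m: "order (lam x1) (q x1) = Suc m" using not0_implies_Suc by blast
  define H where "H x = (pderiv ^^ m) (q x)" for x
  have degH: "degree ((pderiv ^^ j) (q x)) \<le> n" for j x
    using degree_higher_pderiv_le[of j "q x"] deg[of x] by simp
  have diffH: "(\<lambda>x. coeff ((pderiv ^^ j) (q x)) k) differentiable (at x)" if "x \<in> U" for x j k
    by (intro differentiable_coeff_higher_pderiv diff that)
  \<comment> \<open>Minimality forces multiplicity at least \<open>Suc m\<close> on all of
    \<open>U\<close>, not only at \<open>x1\<close>.\<close>
  have rootH: "poly (H x) (lam x) = 0" if "x \<in> U" for x
    unfolding H_def using x1(2)[OF that] m by (intro poly_higher_pderiv_eq_0 nz) simp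
  have isc: "isCont lam x" if "x \<in> U" for x
    using cont that U(1) by (simp add: continuous_on_eq_continuous_at)
  have "isCont (\<lambda>x. poly ((pderiv ^^ Suc m) (q x)) (lam x)) x1"
    by (intro isCont_poly_family[OF degH] isc x1(1)
      differentiable_imp_continuous_within diffH)
  moreover have "poly ((pderiv ^^ Suc m) (q x1)) (lam x1) \<noteq> 0"
    using poly_order_pderiv_neq_0[OF nz, of "lam x1" x1] unfolding m .
  ultimately have "\<forall>\<^sub>F x in nhds x1. poly ((pderiv ^^ Suc m) (q x)) (lam x) \<noteq> 0"
    by (intro tendsto_imp_eventually_ne[OF isCont_imp_tendsto_nhds])
  then obtain W0 where W0: "open W0" "x1 \<in> W0" "\<And>x. x \<in> W0 \<Longrightarrow> poly (pderiv (H x)) (lam x) \<noteq> 0"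
    unfolding eventually_nhds H_def by auto
  show thesis
  proof (rule that[of "W0 \<inter> U"])
    fix x assume x: "x \<in> W0 \<inter> U"
    have "\<forall>\<^sub>F y in nhds x. y \<in> U" using U(1) x by (intro eventually_nhds_in_open) auto
    then have "\<forall>\<^sub>F y in nhds x. poly (H y) (lam y) = 0" by (rule eventually_mono) (rule rootH)
    with x show "lam differentiable (at x)"
      using differentiable_simple_root[of H n x lam] degH[of m] diffH[of x m] isc W0(3) by (simp add: H_def)
  qed (use U W0 x1 in auto)
qed

section \<open>Real analytic functions and characteristic polynomials\<close>

lemma differentiable_prod:
  fixes f :: "'i \<Rightarrow> 'a::real_normed_vector \<Rightarrow> 'b::real_normed_field"
  assumes "\<And>i. i \<in> I \<Longrightarrow> f i differentiable (at x)"
  shows "(\<lambda>x. \<Prod>i\<in>I. f i x) differentiable (at x)"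
  using assms by (induction I rule: infinite_finite_induct) simp_all

text \<open>For real families unconditional and absolute summability agree; this is applied to the
  finitely many coordinates, whose absolute values add up to a bound of the norm.\<close>

lemma abs_summable_if_summable_euclidean:
  fixes f :: "'a \<Rightarrow> 'b::euclidean_space"
  assumes "f summable_on A"
  shows "(\<lambda>x. norm (f x)) summable_on A"
proof -
  have comp: "(\<lambda>x. \<bar>f x \<bullet> b\<bar>) summable_on A" for b
  proof -
    have "(\<lambda>x. f x \<bullet> b) summable_on A"
      using summable_on_bounded_linear[OF bounded_linear_inner_left assms] .
    then show ?thesis using summable_on_iff_abs_summable_on_real[of "\<lambda>x. f x \<bullet> b" A] by simp
  qed
  have "(\<lambda>x. \<Sum>b\<in>C. \<bar>f x \<bullet> b\<bar>) summable_on A" if "finite C" for C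
    using that by induction (simp_all add: summable_on_add comp)
  then have "(\<lambda>x. \<Sum>b\<in>Basis. \<bar>f x \<bullet> b\<bar>) summable_on A" by simp
  then show ?thesis
    by (rule summable_on_comparison_test) (auto simp: norm_le_l1)
qed

text \<open>Absolute convergence at a point of the diagonal through the center bounds the terms of degree
  at least two quadratically.\<close>

lemma real_analytic_imp_differentiable:
  fixes f :: "real ^ 'd \<Rightarrow> 'b::euclidean_space"
  assumes "real_analytic f"
  shows "f differentiable (at x)"
proof -
  obtain r c where r: "0 < r" and c: "\<And>y. y \<in> ball x r \<Longrightarrow>
      ((\<lambda>\<alpha>. (\<Prod>i\<in>UNIV. (y $ i - x $ i) ^ \<alpha> i) *\<^sub>R c \<alpha>) has_sum f y) (UNIV :: ('d \<Rightarrow> nat) set)"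
    using assms unfolding real_analytic_def by blast
  define one :: "real ^ 'd" where "one = (\<chi> i. 1)"
  have none: "0 < norm one" by (simp add: one_def vec_eq_iff)
  \<comment> \<open>The test point \<open>x + \<rho> *\<^sub>R one\<close> has distance
    \<open>r / 2\<close> from the center, and every monomial takes the value
    \<open>\<rho> ^ s \<alpha>\<close> there.\<close>
  define \<rho> where "\<rho> = r / (2 * norm one)"
  have \<rho>: "0 < \<rho>" "x + \<rho> *\<^sub>R one \<in> ball x r"
    using r none by (auto simp: \<rho>_def dist_norm)
  define s where "s \<alpha> = (\<Sum>i\<in>UNIV. \<alpha> i)" for \<alpha> :: "'d \<Rightarrow> nat"
  define m where "m \<alpha> h = (\<Prod>i\<in>UNIV. (h $ i) ^ \<alpha> i)" for \<alpha> and h :: "real ^ 'd"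
  have hs: "((\<lambda>\<alpha>. m \<alpha> h *\<^sub>R c \<alpha>) has_sum f (x + h)) UNIV" if "norm h < r" for h
    using c[of "x + h"] that by (simp add: m_def dist_norm)
  \<comment> \<open>The multi-indices of degree at most one; they carry the affine part
    \<open>g\<close> of the series.\<close>
  define S1 where "S1 = {\<alpha> :: 'd \<Rightarrow> nat. s \<alpha> \<le> 1}"
  have finS1: "finite S1"
  proof (rule finite_subset)
    show "S1 \<subseteq> PiE UNIV (\<lambda>_. {..1})"
    proof
      fix \<alpha> assume "\<alpha> \<in> S1"
      then have "\<alpha> i \<le> 1" for i
        using member_le_sum[of i UNIV \<alpha>] by (simp add: S1_def s_def)
      then show "\<alpha> \<in> PiE UNIV (\<lambda>_. {..1})" by (simp add: PiE_UNIV_domain)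
    qed
    show "finite (PiE (UNIV :: 'd set) (\<lambda>_. {..1::nat}))"
      by (intro finite_PiE) auto
  qed
  have mone: "m \<alpha> (\<rho> *\<^sub>R one) = \<rho> ^ s \<alpha>" for \<alpha>
    by (simp add: m_def one_def s_def power_sum)
  have "(\<lambda>\<alpha>. norm (m \<alpha> (\<rho> *\<^sub>R one) *\<^sub>R c \<alpha>)) summable_on UNIV"
    using c[OF \<rho>(2)] by (intro abs_summable_if_summable_euclidean) (auto simp: m_def summable_on_def)
  then have "(\<lambda>\<alpha>. norm (c \<alpha>) * \<rho> ^ s \<alpha>) summable_on UNIV"
    using \<rho>(1) by (simp add: mone mult.commute)
  then have sum: "(\<lambda>\<alpha>. norm (c \<alpha>) * \<rho> ^ s \<alpha>) summable_on (- S1)"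
    by (rule summable_on_subset_banach) simp
  define M where "M = (\<Sum>\<^sub>\<infinity>\<alpha>\<in>-S1. norm (c \<alpha>) * \<rho> ^ s \<alpha>)"
  define g where "g h = (\<Sum>\<alpha>\<in>S1. m \<alpha> h *\<^sub>R c \<alpha>)" for h
  have bound: "norm (f (x + h) - g h) \<le> (M / \<rho>\<^sup>2) * (norm h)\<^sup>2" if h: "norm h < min r \<rho>" for h
  proof -
    have "((\<lambda>\<alpha>. m \<alpha> h *\<^sub>R c \<alpha>) has_sum (f (x + h) - g h)) (UNIV - S1)"
      using h by (intro has_sum_Diff hs has_sum_finiteI finS1) (auto simp: g_def)
    then have hs': "((\<lambda>\<alpha>. m \<alpha> h *\<^sub>R c \<alpha>) has_sum (f (x + h) - g h)) (- S1)"
      by (simp add: Compl_eq_Diff_UNIV)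
    define t where "t = norm h / \<rho>"
    have t: "0 \<le> t" "t \<le> 1" using h \<rho>(1) by (auto simp: t_def)
    have "norm (f (x + h) - g h) \<le> M * t\<^sup>2"
    proof (rule norm_infsum_le[OF hs'])
      show "((\<lambda>\<alpha>. (norm (c \<alpha>) * \<rho> ^ s \<alpha>) * t\<^sup>2) has_sum M * t\<^sup>2) (- S1)"
        unfolding M_def by (intro has_sum_cmult_left has_sum_infsum sum)
      fix \<alpha> assume "\<alpha> \<in> - S1"
      then have s2: "2 \<le> s \<alpha>" by (simp add: S1_def)
      have "\<bar>m \<alpha> h\<bar> \<le> (\<Prod>i\<in>UNIV. norm h ^ \<alpha> i)"
        unfolding m_def abs_prod power_abs
        by (intro prod_mono conjI power_mono component_le_norm_cart) auto
      also have "\<dots> = (\<rho> * t) ^ s \<alpha>" using \<rho>(1) by (simp add: t_def s_def power_sum)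
      also have "\<dots> = \<rho> ^ s \<alpha> * t ^ s \<alpha>" by (rule power_mult_distrib)
      \<comment> \<open>Since \<open>t \<le> 1\<close> and the degree is at least two,
        \<open>t\<^sup>2\<close> bounds the power uniformly and can be taken out of the infinite
        sum.\<close>
      also have "\<dots> \<le> \<rho> ^ s \<alpha> * t\<^sup>2"
        using t s2 \<rho>(1) by (intro mult_left_mono power_decreasing) auto
      finally have "norm (c \<alpha>) * \<bar>m \<alpha> h\<bar> \<le> norm (c \<alpha>) * (\<rho> ^ s \<alpha> * t\<^sup>2)"
        by (rule mult_left_mono) simp
      then show "norm (m \<alpha> h *\<^sub>R c \<alpha>) \<le> norm (c \<alpha>) * \<rho> ^ s \<alpha> * t\<^sup>2" by (simp add: mult_ac)
    qed
    then show ?thesis by (simp add: t_def power_divide)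
  qed
  have "g differentiable (at 0)"
    unfolding g_def m_def
    by (intro differentiable_sum finS1 ballI differentiable_scaleR differentiable_const differentiable_prod
      differentiable_power bounded_linear_imp_differentiable bounded_linear_vec_nth)
  then obtain D where D: "(g has_derivative D) (at 0)" unfolding differentiable_def by blast
  have "((\<lambda>h. f (x + h) - g h) has_derivative (\<lambda>h. 0)) (at 0)"
  proof (rule has_derivativeI_sandwich)
    show "0 < min r \<rho>" using r \<rho>(1) by simp
    have "((\<lambda>h :: real ^ 'd. (M / \<rho>\<^sup>2) * norm h) \<longlongrightarrow> (M / \<rho>\<^sup>2) * norm (0 :: real ^ 'd)) (at 0)"
      by (rule tendsto_mult_left[OF tendsto_norm[OF tendsto_ident_at]])
    then show "((\<lambda>h. (M / \<rho>\<^sup>2) * norm h) \<longlongrightarrow> 0) (at (0 :: real ^ 'd))" by simp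
    fix h :: "real ^ 'd" assume h: "h \<noteq> 0" "dist h 0 < min r \<rho>"
    have "f (x + 0) = g 0" using bound[of 0] r \<rho>(1) by simp
    then have "norm (f (x + h) - g h - (f (x + 0) - g 0) - 0) \<le> (M / \<rho>\<^sup>2) * norm h * norm h"
      using bound[of h] h(2) by (simp add: power2_eq_square mult.assoc)
    then show "norm (f (x + h) - g h - (f (x + 0) - g 0) - 0) / norm (h - 0) \<le> (M / \<rho>\<^sup>2) * norm h"
      using h(1) by (simp add: pos_divide_le_eq)
  qed simp
  from has_derivative_add[OF this D] have "((\<lambda>h. f (x + h)) has_derivative D) (at (x - x))" by simp
  moreover have "((\<lambda>y. y - x) has_derivative (\<lambda>h. h)) (at x)"
    by (auto intro!: derivative_eq_intros)
  ultimately have "((\<lambda>y. f (x + (y - x))) has_derivative D) (at x)"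
    using has_derivative_compose by fastforce
  then show ?thesis unfolding differentiable_def by auto
qed

text \<open>In the Leibniz expansion a permutation other than the identity picks an off-diagonal,
  hence constant, factor and so stays below degree \<open>CARD('n)\<close>; the diagonal product is
  monic of that degree.\<close>

lemma
  fixes M :: "real ^ 'n ^ 'n"
  shows degree_char_poly: "degree (char_poly M) = CARD('n)"
    and lead_coeff_char_poly: "lead_coeff (char_poly M) = 1"
proof -
  define X :: "complex poly ^ 'n ^ 'n" where "X = mat [:0, 1:] - (\<chi> i j. [:complex_of_real (M $ i $ j):])"
  have X: "X $ i $ j = (if i = j then [:- complex_of_real (M $ i $ j), 1:] else [:- complex_of_real (M $ i $ j):])" for i j
    by (auto simp: X_def mat_def)
  define t where "t p = of_int (sign p) * (\<Prod>i\<in>UNIV. X $ i $ p i)" for p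
  have det: "char_poly M = (\<Sum>p | p permutes UNIV. t p)"
    by (simp add: char_poly_def det_def t_def X_def)
  have deg: "degree (t p) \<le> (\<Sum>i\<in>UNIV. degree (X $ i $ p i))" for p
    unfolding t_def
    by (rule order_trans[OF degree_mult_le]) (simp add: degree_prod_sum_le[unfolded comp_def])
  have X1: "degree (X $ i $ j) \<le> 1" for i j by (simp add: X)
  have le: "degree (t p) \<le> CARD('n)" for p
    using deg[of p] sum_bounded_above[of UNIV "\<lambda>i. degree (X $ i $ p i)" 1] X1 by fastforce
  have lt: "degree (t p) < CARD('n)" if p: "p \<noteq> id" for p
  proof -
    obtain i where "p i \<noteq> i" using p by fastforce
    then have "(\<Sum>i\<in>UNIV. degree (X $ i $ p i)) < (\<Sum>i\<in>(UNIV::'n set). 1)"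
      using X1 by (intro sum_strict_mono_ex1) (auto intro!: exI[of _ i] simp: X)
    with deg[of p] show ?thesis by simp
  qed
  have tid: "t id = (\<Prod>i\<in>UNIV. X $ i $ i)" by (simp add: t_def sign_id)
  have nz: "X $ i $ i \<noteq> 0" for i by (simp add: X)
  have "degree (t id) = (\<Sum>i\<in>(UNIV::'n set). 1)"
    unfolding tid using nz by (subst degree_prod_sum_eq) (simp_all add: X)
  moreover have "lead_coeff (t id) = 1"
    unfolding tid by (simp add: lead_coeff_prod X)
  ultimately have cid: "coeff (t id) CARD('n) = 1" by simp
  have "coeff (char_poly M) CARD('n) = (\<Sum>p | p permutes (UNIV::'n set). if p = id then 1 else 0)"
    unfolding det coeff_sum using cid lt by (intro sum.cong) (auto simp: coeff_eq_0)
  also have "\<dots> = 1" by (simp add: permutes_id finite_permutations)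
  finally have c: "coeff (char_poly M) CARD('n) = 1" .
  have "degree (char_poly M) \<le> CARD('n)"
    unfolding det using le by (intro degree_sum_le) (simp_all add: finite_permutations)
  with c show "degree (char_poly M) = CARD('n)"
    by (metis le_antisym le_degree zero_neq_one)
  with c show "lead_coeff (char_poly M) = 1" by simp
qed

lemma differentiable_coeff_mult:
  fixes p q :: "'a::real_normed_vector \<Rightarrow> 'b::{comm_semiring_0,real_normed_algebra} poly"
  assumes "\<And>k. (\<lambda>x. coeff (p x) k) differentiable (at a)" "\<And>k. (\<lambda>x. coeff (q x) k) differentiable (at a)"
  shows "(\<lambda>x. coeff (p x * q x) k) differentiable (at a)"
  unfolding coeff_mult using assms by (intro differentiable_sum differentiable_mult) auto

lemma differentiable_coeff_prod:
  fixes p :: "'i \<Rightarrow> 'a::real_normed_vector \<Rightarrow> 'b::{comm_semiring_1,real_normed_algebra} poly"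
  assumes "\<And>i k. i \<in> I \<Longrightarrow> (\<lambda>x. coeff (p i x) k) differentiable (at a)"
  shows "(\<lambda>x. coeff (\<Prod>i\<in>I. p i x) k) differentiable (at a)"
  using assms
proof (induction I arbitrary: k rule: infinite_finite_induct)
  case (insert i I)
  then show ?case by (simp add: differentiable_coeff_mult)
qed simp_all

lemma differentiable_coeff_char_poly:
  assumes "A differentiable (at a)"
  shows "(\<lambda>x. coeff (char_poly (A x :: real ^ 'n ^ 'n)) k) differentiable (at a)"
proof -
  have comp: "(\<lambda>x. complex_of_real (A x $ i $ j)) differentiable (at a)" for i j
  proof -
    have "bounded_linear (\<lambda>M. complex_of_real (M $ i $ j))"
      by (intro bounded_linear_compose[OF bounded_linear_of_real]
        bounded_linear_compose[OF bounded_linear_vec_nth] bounded_linear_vec_nth)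
    from differentiable_compose[OF bounded_linear_imp_differentiable[OF this] assms] show ?thesis .
  qed
  have entry: "(\<lambda>x. coeff ((mat [:0, 1:] - (\<chi> i j. [:complex_of_real (A x $ i $ j):])) $ i $ j) l)
    differentiable (at a)" for i j l
    using comp by (cases l) (auto simp: coeff_pCons intro!: differentiable_diff)
  show ?thesis
    unfolding char_poly_def det_def coeff_sum
    by (intro differentiable_sum ballI differentiable_coeff_mult differentiable_coeff_prod entry)
      (simp_all add: finite_permutations)
qed

section \<open>Systems with a common eigenvalue\<close>

text \<open>A complex row vector applied to a real state. There is no conjugation, so that a left
  eigenvector reproduces its own eigenvalue.\<close>

definition cdot :: "complex ^ 'n \<Rightarrow> real ^ 'n \<Rightarrow> complex" where
  "cdot w x = (\<Sum>i\<in>UNIV. w $ i * complex_of_real (x $ i))"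

lemma bounded_linear_cdot: "bounded_linear (cdot w)"
  unfolding linear_conv_bounded_linear[symmetric]
  by (rule linearI) (simp_all add: cdot_def algebra_simps sum.distrib scaleR_sum_right sum_distrib_left scaleR_conv_of_real[where 'a=complex])

lemma cdot_scaleR: "cdot w (r *\<^sub>R x) = of_real r * cdot w x"
  by (simp add: linear_simps[OF bounded_linear_cdot] scaleR_conv_of_real[where 'a=complex])

lemma cdot_matrix_vector_mult:
  "cdot w (M *v x) = cdot (\<chi> j. \<Sum>i\<in>UNIV. w $ i * complex_of_real (M $ i $ j)) x"
proof -
  have "cdot w (M *v x) = (\<Sum>i\<in>UNIV. \<Sum>j\<in>UNIV. w $ i * complex_of_real (M $ i $ j) * complex_of_real (x $ j))"
    by (simp add: cdot_def matrix_vector_mult_def sum_distrib_left mult.assoc)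
  also have "\<dots> = cdot (\<chi> j. \<Sum>i\<in>UNIV. w $ i * complex_of_real (M $ i $ j)) x"
    by (subst sum.swap) (simp add: cdot_def sum_distrib_right)
  finally show ?thesis .
qed

lemma poly_det:
  fixes X :: "'a::comm_ring_1 poly ^ 'n ^ 'n"
  shows "poly (det X) z = det (\<chi> i j. poly (X $ i $ j) z)"
  by (simp add: det_def poly_sum poly_prod)

text \<open>The matrix \<open>N\<close>, which is \<open>z\<close> times the identity minus
  \<open>M\<close>, is singular, and a kernel vector of its transpose is an eigenvector acting from
  the left.\<close>

lemma left_eigenvector_exists:
  fixes M :: "real ^ 'n ^ 'n"
  assumes "poly (char_poly M) z = 0"
  obtains w where "w \<noteq> 0" "\<And>x. cdot w (M *v x) = z * cdot w x"
proof -
  define N :: "complex ^ 'n ^ 'n" where "N = mat z - (\<chi> i j. complex_of_real (M $ i $ j))"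
  have "(\<chi> i j. poly ((mat [:0, 1:] - (\<chi> i j. [:complex_of_real (M $ i $ j):])) $ i $ j) z) = N"
    by (auto simp: N_def vec_eq_iff mat_def)
  with assms have "det (transpose N) = 0"
    by (simp add: char_poly_def poly_det)
  then have "\<not> (\<exists>B. B ** transpose N = mat 1)"
    by (metis invertible_det_nz invertible_left_inverse)
  then obtain w where w: "transpose N *v w = 0" "w \<noteq> 0"
    unfolding matrix_left_invertible_ker by blast
  have eig: "(\<Sum>i\<in>UNIV. w $ i * complex_of_real (M $ i $ j)) = z * w $ j" for j
  proof -
    have "0 = (transpose N *v w) $ j" using w by simp
    also have "\<dots> = (\<Sum>i\<in>UNIV. (mat z :: complex^'n^'n) $ i $ j * w $ i - w $ i * complex_of_real (M $ i $ j))"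
      by (simp add: N_def matrix_vector_mult_def transpose_def algebra_simps)
    also have "\<dots> = z * w $ j - (\<Sum>i\<in>UNIV. w $ i * complex_of_real (M $ i $ j))"
      by (simp add: sum_subtractf mat_def if_distrib[of "\<lambda>x. x * _"] cong: if_cong)
    finally show ?thesis by simp
  qed
  have "cdot w (M *v x) = z * cdot w x" for x
    unfolding cdot_matrix_vector_mult eig by (simp add: cdot_def sum_distrib_left mult.assoc)
  with w(2) show thesis by (rule that)
qed

text \<open>Stated for an indexed family because \<open>b\<close> may repeat a value. Two equal
  values cancel with coefficients 1 and -1; otherwise the image has more elements than the
  dimension.\<close>

lemma complex_vectors_dependent:
  fixes b :: "'a \<Rightarrow> complex ^ 'm"
  assumes "finite F" "CARD('m) < card F"
  obtains c a where "a \<in> F" "c a \<noteq> 0" "(\<Sum>x\<in>F. c x *s b x) = 0"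
proof (cases "inj_on b F")
  case False
  then obtain x y where xy: "x \<in> F" "y \<in> F" "x \<noteq> y" "b x = b y" by (auto simp: inj_on_def)
  define c :: "'a \<Rightarrow> complex" where "c z = (if z = x then 1 else if z = y then -1 else 0)" for z
  have "(\<Sum>z\<in>F. c z *s b z) = (\<Sum>z\<in>{x, y}. c z *s b z)"
    using xy assms(1) by (intro sum.mono_neutral_right) (auto simp: c_def)
  also have "\<dots> = 0" using xy(3,4) by (simp add: c_def)
  finally show thesis using that[of x c] xy(1) by (simp add: c_def)
next
  case True
  then have "card (b ` F) = card F" by (rule card_image)
  then have "vec.dependent (b ` F)"
    using assms(2) vec.independent_card_le_dim[of "b ` F" UNIV] vec_dim_card[where 'a=complex and 'n='m] by fastforce
  then obtain u v where "v \<in> b ` F" "u v \<noteq> 0" "(\<Sum>v\<in>b ` F. u v *s v) = 0"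
    using vec.dependent_finite[of "b ` F"] assms(1) by auto
  then show thesis
    using that[of _ "u \<circ> b"] True by (auto simp: sum.reindex)
qed

section \<open>Matrix powers and the matrix exponential\<close>

lemma cdot_matrix_power:
  fixes M :: "real ^ 'n ^ 'n"
  assumes "\<And>x. cdot w (M *v x) = z * cdot w x"
  shows "cdot w (matrix_power M k *v x) = z ^ k * cdot w x"
  by (induction k) (simp_all add: matrix_power_def assms matrix_vector_mul_assoc[symmetric])

lemma bounded_bilinear_matrix_mult:
  "bounded_bilinear ((**) :: real ^ 'n ^ 'm \<Rightarrow> real ^ 'k ^ 'n \<Rightarrow> real ^ 'k ^ 'm)"
  unfolding bilinear_conv_bounded_bilinear[symmetric] bilinear_def
  by (auto intro!: linearI simp: vec_eq_iff matrix_matrix_mult_def algebra_simps sum.distrib sum_distrib_left)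

text \<open>Bounded bilinearity makes the norm submultiplicative up to a constant, which is absorbed
  into \<open>K\<close>. Geometric growth permits comparison with the exponential series.\<close>

lemma norm_matrix_power_bound:
  fixes M :: "real ^ 'n ^ 'n"
  obtains C K where "\<And>k. norm (matrix_power M k) \<le> C * K ^ k" "0 \<le> C" "0 \<le> K"
proof -
  obtain K where K: "0 < K" "\<And>(X :: real ^ 'n ^ 'n) (Y :: real ^ 'n ^ 'n). norm (X ** Y) \<le> norm X * norm Y * K"
    using bounded_bilinear.pos_bounded[OF bounded_bilinear_matrix_mult] by metis
  have "norm (matrix_power M k) \<le> norm (mat 1 :: real ^ 'n ^ 'n) * (norm M * K) ^ k" for k
  proof (induction k)
    case (Suc k)
    have "norm (matrix_power M (Suc k)) \<le> norm M * norm (matrix_power M k) * K"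
      using K(2)[of M "matrix_power M k"] by (simp add: matrix_power_def)
    also have "\<dots> \<le> norm M * (norm (mat 1 :: real ^ 'n ^ 'n) * (norm M * K) ^ k) * K"
      using Suc K(1) by (intro mult_right_mono mult_left_mono) auto
    finally show ?case by (simp add: mult_ac)
  qed (simp add: matrix_power_def)
  then show thesis using that[of "norm (mat 1 :: real ^ 'n ^ 'n)" "norm M * K"] K(1) by simp
qed

lemma summable_matrix_exp:
  fixes M :: "real ^ 'n ^ 'n"
  shows "summable (\<lambda>k. (1 / fact k) *\<^sub>R matrix_power M k)"
proof -
  obtain C K where CK: "\<And>k. norm (matrix_power M k) \<le> C * K ^ k" "0 \<le> C" "0 \<le> K"
    using norm_matrix_power_bound by blast
  have "summable (\<lambda>k. C * (K ^ k /\<^sub>R fact k))"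
    by (intro summable_mult summable_exp_generic)
  then show ?thesis
    by (rule summable_comparison_test'[where N=0]) (use CK(1) in \<open>simp add: field_simps\<close>)
qed

text \<open>The map taking \<open>X\<close> to \<open>cdot w (X *v x)\<close> is bounded linear,
  hence commutes with the series.\<close>

lemma cdot_matrix_exp:
  fixes M :: "real ^ 'n ^ 'n"
  assumes "\<And>x. cdot w (M *v x) = z * cdot w x"
  shows "cdot w (matrix_exp M *v x) = exp z * cdot w x"
proof -
  have lin: "bounded_linear (\<lambda>X. cdot w (X *v x))"
    unfolding linear_conv_bounded_linear[symmetric]
    by (rule linearI)
      (simp_all add: matrix_vector_mult_add_rdistrib scaleR_matrix_vector_assoc[symmetric]
        linear_simps[OF bounded_linear_cdot])
  have "cdot w (matrix_exp M *v x) = (\<Sum>k. cdot w (((1 / fact k) *\<^sub>R matrix_power M k) *v x))"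
    unfolding matrix_exp_def by (rule bounded_linear.suminf[OF lin summable_matrix_exp])
  also have "\<dots> = (\<Sum>k. (z ^ k /\<^sub>R fact k) * cdot w x)"
    by (simp add: scaleR_matrix_vector_assoc[symmetric] linear_simps[OF bounded_linear_cdot]
      cdot_matrix_power[OF assms] inverse_eq_divide)
  also have "\<dots> = exp z * cdot w x"
    unfolding exp_def by (rule suminf_mult2[symmetric]) (rule summable_exp_generic)
  finally show ?thesis .
qed

lemma matrix_power_scaleR:
  fixes M :: "real ^ 'n ^ 'n"
  shows "matrix_power (t *\<^sub>R M) k = t ^ k *\<^sub>R matrix_power M k"
proof (induction k)
  case (Suc k)
  then show ?case
    by (simp add: matrix_power_def bounded_bilinear.scaleR_left[OF bounded_bilinear_matrix_mult]
      bounded_bilinear.scaleR_right[OF bounded_bilinear_matrix_mult])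
qed (simp add: matrix_power_def)

text \<open>The Weierstrass test applies on bounded sets of times. Continuity makes the kernel of
  the state integral measurable and bounded.\<close>

lemma continuous_on_matrix_exp_scaleR:
  fixes M :: "real ^ 'n ^ 'n"
  assumes "bounded I"
  shows "continuous_on I (\<lambda>t. matrix_exp (t *\<^sub>R M))"
proof -
  obtain C K where CK: "\<And>k. norm (matrix_power M k) \<le> C * K ^ k" "0 \<le> C" "0 \<le> K"
    using norm_matrix_power_bound by blast
  obtain R where R: "\<And>t. t \<in> I \<Longrightarrow> norm t \<le> R"
    using assms bounded_iff by blast
  have "uniform_limit I (\<lambda>n t. \<Sum>k<n. (1 / fact k) *\<^sub>R matrix_power (t *\<^sub>R M) k)
    (\<lambda>t. matrix_exp (t *\<^sub>R M)) sequentially"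
    unfolding matrix_exp_def
  proof (rule Weierstrass_m_test)
    show "summable (\<lambda>k. C * ((\<bar>R\<bar> * K) ^ k /\<^sub>R fact k))"
      by (intro summable_mult summable_exp_generic)
    fix k t assume "t \<in> I"
    then have "\<bar>t\<bar> ^ k * norm (matrix_power M k) \<le> \<bar>R\<bar> ^ k * (C * K ^ k)"
      using CK R[of t] by (intro mult_mono power_mono) auto
    then show "norm ((1 / fact k) *\<^sub>R matrix_power (t *\<^sub>R M) k) \<le> C * ((\<bar>R\<bar> * K) ^ k /\<^sub>R fact k)"
      by (simp add: matrix_power_scaleR power_abs field_simps)
  qed
  moreover have "continuous_on I (\<lambda>t. \<Sum>k<n. (1 / fact k) *\<^sub>R matrix_power (t *\<^sub>R M) k)" for n
    unfolding matrix_power_scaleR by (intro continuous_intros)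
  ultimately show ?thesis
    using uniform_limit_theorem by (metis (no_types, lifting) eventually_sequentiallyI trivial_limit_sequentially)
qed

section \<open>Reachable states seen through a left eigenvector\<close>

lemma cdot_state_disc:
  assumes "\<And>x. cdot w (A \<theta> *v x) = z * cdot w x"
  shows "cdot w (state_disc A B T \<theta> u) = (\<Sum>k<T. z ^ k * cdot w (B \<theta> *v u (T - 1 - k)))"
  unfolding state_disc_def
  by (simp add: linear_sum[OF bounded_linear.linear[OF bounded_linear_cdot]] cdot_matrix_power[OF assms])

text \<open>The eigenvector turns the matrix kernel into a scalar factor determined by
  \<open>z\<close>. Integrability is recorded too, because a finite sum is later moved inside the
  integral.\<close>

lemma
  assumes eig: "\<And>x. cdot w (A \<theta> *v x) = z * cdot w x"
    and u: "u absolutely_integrable_on {0..T}"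
  shows cdot_state_cont: "cdot w (state_cont A B T \<theta> u) =
      (LINT s:{0..T}|lebesgue. exp (of_real (T - s) * z) * cdot w (B \<theta> *v u s))" (is ?int)
    and integrable_cdot_state_cont:
      "(\<lambda>s. exp (of_real (T - s) * z) * cdot w (B \<theta> *v u s)) absolutely_integrable_on {0..T}" (is ?able)
proof -
  define E where "E s = matrix_exp ((T - s) *\<^sub>R A \<theta>)" for s
  have cont: "continuous_on {0..T} E"
    unfolding E_def
    by (rule continuous_on_compose2[OF continuous_on_matrix_exp_scaleR[of "{0..T}"]])
      (auto intro!: continuous_intros)
  have bil: "bilinear (\<lambda>X v. X *v (B \<theta> *v v))"
    unfolding bilinear_def
    by (auto intro!: linearI simp: matrix_vector_mult_add_rdistrib scaleR_matrix_vector_assoc[symmetric]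
      matrix_vector_right_distrib matrix_vector_mult_scaleR)
  have abs: "(\<lambda>s. E s *v (B \<theta> *v u s)) absolutely_integrable_on {0..T}"
    by (rule absolutely_integrable_bounded_measurable_product[OF bil _ _ _ u])
      (auto intro!: continuous_imp_measurable_on_sets_lebesgue cont compact_imp_bounded
        compact_continuous_image)
  have eq: "cdot w (E s *v (B \<theta> *v u s)) = exp (of_real (T - s) * z) * cdot w (B \<theta> *v u s)" for s
    unfolding E_def
    by (rule cdot_matrix_exp)
      (simp add: scaleR_matrix_vector_assoc[symmetric] cdot_scaleR eig)
  show ?able
    using absolutely_integrable_linear[OF abs bounded_linear_cdot[of w]] by (simp add: comp_def eq)
  show ?int
    unfolding state_cont_def E_def[symmetric] eq[symmetric]
    using integral_bounded_linear[OF bounded_linear_cdot[of w] abs[unfolded set_integrable_def]]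
    by (simp add: set_lebesgue_integral_def linear_simps[OF bounded_linear_cdot])
qed

text \<open>The functional \<open>L\<close> depends on finitely many values and is continuous for
  uniform approximation. If every continuous target is a limit of zeros of \<open>L\<close>, then
  \<open>L\<close> vanishes on all targets, which the target \<open>y\<close> refutes.\<close>

lemma annihilator_trivial:
  fixes P :: "'a::real_normed_vector set" and w :: "'a \<Rightarrow> complex ^ 'n"
  assumes F: "finite F" "F \<subseteq> P" "a \<in> F" "c a \<noteq> 0" "w a \<noteq> 0"
    and approx: "\<And>y \<epsilon>. continuous_on P y \<Longrightarrow> 0 < \<epsilon> \<Longrightarrow>
      \<exists>x. (\<forall>\<theta>\<in>P. norm (x \<theta> - y \<theta>) < \<epsilon>) \<and> (\<Sum>\<theta>\<in>F. c \<theta> * cdot (w \<theta>) (x \<theta>)) = 0"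
  shows False
proof -
  define L where "L x = (\<Sum>\<theta>\<in>F. c \<theta> * cdot (w \<theta>) (x \<theta>))" for x
  obtain i where i: "w a $ i \<noteq> 0" using F(5) by (auto simp: vec_eq_iff)
  \<comment> \<open>A continuous function vanishing at all points of \<open>F\<close> except
    \<open>a\<close>; only the summand at \<open>a\<close> survives in \<open>L y\<close>.\<close>
  define g where "g \<theta> = (\<Prod>\<theta>'\<in>F - {a}. norm (\<theta> - \<theta>'))" for \<theta>
  have ga: "g a \<noteq> 0" using F(1) by (simp add: g_def)
  have g0: "g \<theta> = 0" if "\<theta> \<in> F - {a}" for \<theta> using that F(1) by (auto simp: g_def intro!: prod_zero bexI[of _ \<theta>])
  define y where "y \<theta> = g \<theta> *\<^sub>R (axis i 1 :: real ^ 'n)" for \<theta>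
  have "continuous_on P y" unfolding y_def g_def by (intro continuous_intros)
  have "L y = (\<Sum>\<theta>\<in>{a}. c \<theta> * cdot (w \<theta>) (y \<theta>))"
    unfolding L_def using F g0 by (intro sum.mono_neutral_right) (auto simp: y_def cdot_def)
  also have "\<dots> = c a * (of_real (g a) * w a $ i)"
    by (simp add: y_def cdot_scaleR) (simp add: cdot_def axis_def if_distrib[of complex_of_real] if_distrib[of "\<lambda>x. _ * x"] cong: if_cong)
  finally have Ly: "L y \<noteq> 0" using F(4) ga i by simp
  have "\<forall>\<theta>. \<exists>K>0. \<forall>x. norm (cdot (w \<theta>) x) \<le> norm x * K"
    using bounded_linear.pos_bounded[OF bounded_linear_cdot] by blast
  then obtain K where K: "\<And>\<theta>. 0 < K \<theta>" "\<And>\<theta> x. norm (cdot (w \<theta>) x) \<le> norm x * K \<theta>"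
    by metis
  define S where "S = (\<Sum>\<theta>\<in>F. norm (c \<theta>) * K \<theta>)"
  have S: "0 \<le> S" unfolding S_def using K(1) by (intro sum_nonneg) (simp add: less_imp_le)
  \<comment> \<open>\<open>S\<close> is a Lipschitz constant of \<open>L\<close>; the summand 1
    excludes division by zero and makes the final estimate strict.\<close>
  define \<epsilon> where "\<epsilon> = norm (L y) / (S + 1)"
  have \<epsilon>: "0 < \<epsilon>" using Ly S by (simp add: \<epsilon>_def)
  obtain x where x: "\<And>\<theta>. \<theta> \<in> P \<Longrightarrow> norm (x \<theta> - y \<theta>) < \<epsilon>" "L x = 0"
    using approx[OF \<open>continuous_on P y\<close> \<epsilon>] unfolding L_def by blast
  have "L x - L y = (\<Sum>\<theta>\<in>F. c \<theta> * cdot (w \<theta>) (x \<theta> - y \<theta>))"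
    by (simp add: L_def linear_simps[OF bounded_linear_cdot] algebra_simps sum_subtractf)
  then have "L y = - (\<Sum>\<theta>\<in>F. c \<theta> * cdot (w \<theta>) (x \<theta> - y \<theta>))"
    using x(2) by (metis add.inverse_inverse diff_0)
  then have "norm (L y) \<le> (\<Sum>\<theta>\<in>F. norm (c \<theta> * cdot (w \<theta>) (x \<theta> - y \<theta>)))"
    using norm_sum[of "\<lambda>\<theta>. c \<theta> * cdot (w \<theta>) (x \<theta> - y \<theta>)" F] by simp
  also have "\<dots> \<le> (\<Sum>\<theta>\<in>F. norm (c \<theta>) * K \<theta> * \<epsilon>)"
  proof (rule sum_mono)
    fix \<theta> assume "\<theta> \<in> F"
    then have "norm (x \<theta> - y \<theta>) * K \<theta> \<le> \<epsilon> * K \<theta>"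
      using x(1) F(2) K(1) by (intro mult_right_mono) (auto simp: less_imp_le)
    then have "norm (cdot (w \<theta>) (x \<theta> - y \<theta>)) \<le> K \<theta> * \<epsilon>"
      using K(2)[of \<theta> "x \<theta> - y \<theta>"] by (simp add: mult.commute)
    then show "norm (c \<theta> * cdot (w \<theta>) (x \<theta> - y \<theta>)) \<le> norm (c \<theta>) * K \<theta> * \<epsilon>"
      by (simp add: norm_mult mult.assoc mult_left_mono)
  qed
  also have "\<dots> = S * \<epsilon>" by (simp add: S_def sum_distrib_right)
  also have "\<dots> < (S + 1) * \<epsilon>" using \<epsilon> by simp
  also have "\<dots> = norm (L y)" using S by (simp add: \<epsilon>_def)
  finally show False by simp
qed

lemma norm_less_if_SUP_less:
  fixes f :: "'a \<Rightarrow> 'b::real_normed_vector"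
  assumes "(SUP \<theta>\<in>P. ereal (norm (f \<theta>))) < ereal \<epsilon>" "\<theta> \<in> P"
  shows "norm (f \<theta>) < \<epsilon>"
  using order.strict_trans1[OF SUP_upper[OF assms(2), of "\<lambda>\<theta>. ereal (norm (f \<theta>))"] assms(1)] by simp

lemma finite_common_eigenvalue:
  fixes A :: "real ^ 'd \<Rightarrow> real ^ 'n ^ 'n" and B :: "real ^ 'd \<Rightarrow> real ^ 'm ^ 'n"
  assumes contr: "uniformly_ensemble_controllable_cont P A B \<or> uniformly_ensemble_controllable_disc P A B"
  shows "finite {\<theta>\<in>P. poly (char_poly (A \<theta>)) z = 0}"
proof (rule ccontr)
  assume "infinite {\<theta>\<in>P. poly (char_poly (A \<theta>)) z = 0}"
  \<comment> \<open>One point more than the dimension of the space of the vectors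
    \<open>b \<theta>\<close>.\<close>
  then obtain F where F: "finite F" "card F = Suc CARD('m)" "F \<subseteq> {\<theta>\<in>P. poly (char_poly (A \<theta>)) z = 0}"
    using infinite_arbitrarily_large[of _ "Suc CARD('m)"] by blast
  have "\<exists>w. w \<noteq> 0 \<and> (\<forall>x. cdot w (A \<theta> *v x) = z * cdot w x)" if "\<theta> \<in> F" for \<theta>
    using that F(3) left_eigenvector_exists[of "A \<theta>" z] by blast
  then obtain w where w: "\<And>\<theta>. \<theta> \<in> F \<Longrightarrow> w \<theta> \<noteq> 0"
    "\<And>\<theta> x. \<theta> \<in> F \<Longrightarrow> cdot (w \<theta>) (A \<theta> *v x) = z * cdot (w \<theta>) x"
    by metis
  define b :: "real ^ 'd \<Rightarrow> complex ^ 'm" where "b \<theta> = (\<chi> j. \<Sum>i\<in>UNIV. w \<theta> $ i * complex_of_real (B \<theta> $ i $ j))" for \<theta>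
  have wb: "cdot (w \<theta>) (B \<theta> *v v) = cdot (b \<theta>) v" for \<theta> v
    by (simp add: cdot_matrix_vector_mult b_def)
  obtain a c where c: "a \<in> F" "c a \<noteq> 0" "(\<Sum>\<theta>\<in>F. c \<theta> *s b \<theta>) = 0"
    by (rule complex_vectors_dependent[of F b]) (use F in auto)
  \<comment> \<open>The same coefficients annihilate the \<open>b \<theta>\<close> against every
    input value, hence at every time.\<close>
  have zero: "(\<Sum>\<theta>\<in>F. c \<theta> * cdot (b \<theta>) v) = 0" for v
  proof -
    have "(\<Sum>\<theta>\<in>F. c \<theta> * cdot (b \<theta>) v) = cdot (\<Sum>\<theta>\<in>F. c \<theta> *s b \<theta>) v"
      unfolding cdot_def by (simp add: sum_distrib_left sum_distrib_right mult.assoc) (rule sum.swap)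
    then show ?thesis by (simp add: c(3) cdot_def)
  qed
  show False
  proof (rule annihilator_trivial[where F = F and P = P and a = a and c = c and w = w])
    fix y :: "real ^ 'd \<Rightarrow> real ^ 'n" and \<epsilon> :: real
    assume y: "continuous_on P y" "0 < \<epsilon>"
    from contr show "\<exists>x. (\<forall>\<theta>\<in>P. norm (x \<theta> - y \<theta>) < \<epsilon>) \<and> (\<Sum>\<theta>\<in>F. c \<theta> * cdot (w \<theta>) (x \<theta>)) = 0"
    proof
      assume "uniformly_ensemble_controllable_cont P A B"
      then obtain T u where u: "u absolutely_integrable_on {0..T}"
        "(SUP \<theta>\<in>P. ereal (norm (state_cont A B T \<theta> u - y \<theta>))) < ereal \<epsilon>"
        using y unfolding uniformly_ensemble_controllable_cont_def by blast
      have "cdot (w \<theta>) (state_cont A B T \<theta> u) =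
          (LINT s:{0..T}|lebesgue. exp (of_real (T - s) * z) * cdot (b \<theta>) (u s))" if "\<theta> \<in> F" for \<theta>
        using cdot_state_cont[where A = A and B = B and \<theta> = \<theta>, OF w(2)[OF that] u(1)] by (simp only: wb)
      then have "(\<Sum>\<theta>\<in>F. c \<theta> * cdot (w \<theta>) (state_cont A B T \<theta> u)) =
          (\<Sum>\<theta>\<in>F. LINT s:{0..T}|lebesgue. c \<theta> * (exp (of_real (T - s) * z) * cdot (b \<theta>) (u s)))"
        by (intro sum.cong) simp_all
      also have "\<dots> = (LINT s:{0..T}|lebesgue. (\<Sum>\<theta>\<in>F. c \<theta> * (exp (of_real (T - s) * z) * cdot (b \<theta>) (u s))))"
        unfolding set_lebesgue_integral_def scaleR_sum_right
        by (rule Bochner_Integration.integral_sum[symmetric], fold set_integrable_def)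
          (intro set_integrable_mult_right impI
            integrable_cdot_state_cont[where A = A and B = B, OF w(2) u(1), unfolded wb])
      also have "\<dots> = 0"
      proof -
        \<comment> \<open>The exponential factor is common to all points of \<open>F\<close> because
          \<open>z\<close> is, so the integrand vanishes identically.\<close>
        have "(\<Sum>\<theta>\<in>F. c \<theta> * (exp (of_real (T - s) * z) * cdot (b \<theta>) (u s))) =
          exp (of_real (T - s) * z) * (\<Sum>\<theta>\<in>F. c \<theta> * cdot (b \<theta>) (u s))" for s
          by (simp add: sum_distrib_left mult.left_commute)
        then show ?thesis by (simp add: zero set_lebesgue_integral_def)
      qed
      finally show ?thesis
        using norm_less_if_SUP_less[OF u(2)] by (intro exI[of _ "\<lambda>\<theta>. state_cont A B T \<theta> u"]) simp
    next
      assume "uniformly_ensemble_controllable_disc P A B"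
      then obtain T u where u: "(SUP \<theta>\<in>P. ereal (norm (state_disc A B T \<theta> u - y \<theta>))) < ereal \<epsilon>"
        using y unfolding uniformly_ensemble_controllable_disc_def by blast
      have "(\<Sum>\<theta>\<in>F. c \<theta> * cdot (w \<theta>) (state_disc A B T \<theta> u)) =
          (\<Sum>\<theta>\<in>F. \<Sum>k<T. z ^ k * (c \<theta> * cdot (b \<theta>) (u (T - 1 - k))))"
        by (intro sum.cong) (simp_all add: cdot_state_disc[where A = A and B = B, OF w(2)] wb sum_distrib_left mult.left_commute)
      also have "\<dots> = 0"
        by (subst sum.swap) (simp add: sum_distrib_left[symmetric] zero)
      finally show ?thesis
        using norm_less_if_SUP_less[OF u] by (intro exI[of _ "\<lambda>\<theta>. state_disc A B T \<theta> u"]) simp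
    qed
  qed (use F c w(1) in auto)
qed

section \<open>Dimension bounds from the finiteness of fibers\<close>

theorem theorem4:
  fixes P :: "(real ^ 'd) set"
    and A :: "real ^ 'd \<Rightarrow> real ^ 'n ^ 'n"
    and B :: "real ^ 'd \<Rightarrow> real ^ 'm ^ 'n"
  assumes "P \<noteq> {}" and "compact P" and "closure (interior P) = P"
    and "real_analytic (\<lambda>\<theta>. (A \<theta>, B \<theta>))"
    and "uniformly_ensemble_controllable_cont P A B \<or> uniformly_ensemble_controllable_disc P A B"
  shows "aff_dim P \<le> 2 \<and>
     (\<forall>lam. eigenvalue_branches P A lam \<longrightarrow>
        (\<exists>S k. subspace S \<and> dim S = 1 \<and> lam k ` P \<subseteq> S) \<longrightarrow> aff_dim P = 1) \<and>
     (\<forall>lam. eigenvalue_branches P A lam \<longrightarrow>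
        (\<exists>k. lam k ` P \<subseteq> \<real>) \<longrightarrow> aff_dim P = 1)"
proof -
  have aff: "aff_dim P = int CARD('d)"
    by (rule aff_dim_eq_CARD_if_regular_closed) fact+
  define q where "q \<theta> = char_poly (A \<theta>)" for \<theta>
  have deg: "degree (q \<theta>) = CARD('n)" and monic: "lead_coeff (q \<theta>) = 1" for \<theta>
    unfolding q_def by (fact degree_char_poly, fact lead_coeff_char_poly)
  have qnz: "q \<theta> \<noteq> 0" for \<theta> using monic[of \<theta>] by auto
  have diff: "(\<lambda>\<theta>. coeff (q \<theta>) k) differentiable (at \<theta>)" for \<theta> k
  proof -
    have "(\<lambda>\<theta>. fst (A \<theta>, B \<theta>)) differentiable (at \<theta>)"
      by (rule differentiable_compose[OF bounded_linear_imp_differentiable[OF bounded_linear_fst]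
        real_analytic_imp_differentiable]) fact
    then show ?thesis unfolding q_def by (intro differentiable_coeff_char_poly) simp
  qed
  \<comment> \<open>A given enumeration of the eigenvalues need not be continuous; the branches
    \<open>mu i\<close> are continuous and list the distinct eigenvalues on an open set.\<close>
  obtain V and I :: "complex set" and mu where V: "open V" "V \<noteq> {}" "V \<subseteq> interior P"
    and I: "finite I" "\<And>i. i \<in> I \<Longrightarrow> continuous_on V (mu i)"
      "\<And>\<theta>. \<theta> \<in> V \<Longrightarrow> {z. poly (q \<theta>) z = 0} = (\<lambda>i. mu i \<theta>) ` I"
  proof (rule continuous_root_branches[of "interior P" q "CARD('n)"])
    show "interior P \<noteq> {}" using assms(1,3) by auto
    show "isCont (\<lambda>\<theta>. coeff (q \<theta>) k) \<theta>" for \<theta> k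
      using diff by (rule differentiable_imp_continuous_within)
  qed (use deg monic in auto)
  have VP: "V \<subseteq> P" using V(3) interior_subset by blast
  have fiber: "finite {\<theta>\<in>W. mu i \<theta> = z}" if "W \<subseteq> V" "i \<in> I" for W i z
  proof (rule finite_subset)
    show "finite {\<theta>\<in>P. poly (char_poly (A \<theta>)) z = 0}" by (rule finite_common_eigenvalue) fact
    show "{\<theta>\<in>W. mu i \<theta> = z} \<subseteq> {\<theta>\<in>P. poly (char_poly (A \<theta>)) z = 0}"
      using that VP I(3) unfolding q_def by blast
  qed
  have "CARD('d) \<le> 2"
  proof (rule ccontr)
    assume dim: "\<not> CARD('d) \<le> 2"
    obtain \<theta> where \<theta>: "\<theta> \<in> V" using V(2) by blast
    \<comment> \<open>The degree \<open>CARD('n)\<close> is positive, so at least one branch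
      exists.\<close>
    have "\<exists>z. poly (q \<theta>) z = 0"
      using deg[of \<theta>] by (intro fundamental_theorem_of_algebra_alt) (auto simp: degree_pCons_eq_if) 
    then obtain i where i: "i \<in> I" using I(3)[OF \<theta>] by auto
    obtain W where W: "open W" "W \<noteq> {}" "W \<subseteq> V" "\<And>\<theta>. \<theta> \<in> W \<Longrightarrow> mu i differentiable (at \<theta>)"
    proof (rule differentiable_root_branch[of V q "CARD('n)" "mu i"])
      show "poly (q \<theta>) (mu i \<theta>) = 0" if "\<theta> \<in> V" for \<theta> using I(3)[OF that] i by blast
    qed (use V deg qnz diff I(2)[OF i] in auto)
    define L :: "complex \<Rightarrow> real ^ 2" where "L z = Re z *\<^sub>R axis 1 1 + Im z *\<^sub>R axis 2 1" for z
    have "bounded_linear L"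
      unfolding L_def
      by (intro bounded_linear_add bounded_linear_compose[OF bounded_linear_scaleR_left]
        bounded_linear_Re bounded_linear_Im)
    then have diffL: "(\<lambda>\<theta>. L (mu i \<theta>)) differentiable (at \<theta>)" if "\<theta> \<in> W" for \<theta>
      by (rule differentiable_compose[OF bounded_linear_imp_differentiable W(4)[OF that]])
    have L: "L z $ 1 = Re z" "L z $ 2 = Im z" for z by (simp_all add: L_def axis_def)
    have injL: "L z = L w \<longleftrightarrow> z = w" for z w
      using L by (metis complex_eqI)
    obtain v where v: "infinite {\<theta>\<in>W. L (mu i \<theta>) = v}"
      by (rule infinite_fiber_differentiable[OF W(1,2) diffL]) (use dim in auto)
    then obtain \<theta>' where "L (mu i \<theta>') = v"
      using infinite_imp_nonempty by blast
    then have "{\<theta>\<in>W. L (mu i \<theta>) = v} = {\<theta>\<in>W. mu i \<theta> = mu i \<theta>'}" using injL by auto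
    with v fiber[OF W(3) i] show False by simp
  qed
  moreover have line: "aff_dim P = 1"
    if lam: "eigenvalue_branches P A lam" and S: "subspace S" "dim S = 1" "lam k ` P \<subseteq> S" for lam S k
  proof (rule ccontr)
    assume "aff_dim P \<noteq> 1"
    then have dim: "2 \<le> CARD('d)"
      using aff by (metis One_nat_def Suc_1 Suc_leI le_neq_implies_less of_nat_1 zero_less_card_finite)
    have root: "poly (q \<theta>) (lam k \<theta>) = 0" if "\<theta> \<in> P" for \<theta>
    proof -
      have "lam k \<theta> \<in># image_mset (\<lambda>k. lam k \<theta>) (mset_set UNIV)" by simp
      also have "image_mset (\<lambda>k. lam k \<theta>) (mset_set UNIV) = proots (q \<theta>)"
        using lam that unfolding eigenvalue_branches_def q_def by blast
      finally show ?thesis using qnz by simp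
    qed
    \<comment> \<open>\<open>lam k\<close> may jump between the branches, so no \<open>mu i\<close>
      is known to stay in \<open>S\<close>. But leaving the closed set \<open>S\<close> is an open
      condition: near a point \<open>J\<close> cannot grow, and where its size is least it is
      locally constant.\<close>
    define J where "J \<theta> = {i\<in>I. mu i \<theta> \<in> S}" for \<theta>
    have finJ: "finite (J \<theta>)" for \<theta> using I(1) by (simp add: J_def)
    obtain \<theta>1 where \<theta>1: "\<theta>1 \<in> V" "\<And>\<theta>. \<theta> \<in> V \<Longrightarrow> card (J \<theta>1) \<le> card (J \<theta>)"
      using ex_has_least_nat[of "\<lambda>\<theta>. \<theta> \<in> V" _ "\<lambda>\<theta>. card (J \<theta>)"] V(2) by blast
    \<comment> \<open>The value of \<open>lam k\<close> at \<open>\<theta>1\<close> lies in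
      \<open>S\<close> and belongs to some branch.\<close>
    obtain i where i: "i \<in> J \<theta>1"
    proof -
      have "\<theta>1 \<in> P" using \<theta>1(1) VP by blast
      then have "lam k \<theta>1 \<in> S" "lam k \<theta>1 \<in> {z. poly (q \<theta>1) z = 0}"
        using S(3) root by auto
      then have "lam k \<theta>1 \<in> S" "lam k \<theta>1 \<in> (\<lambda>i. mu i \<theta>1) ` I"
        unfolding I(3)[OF \<theta>1(1)] by auto
      then show ?thesis using that by (auto simp: J_def)
    qed
    \<comment> \<open>Branches outside \<open>S\<close> at \<open>\<theta>1\<close> remain outside
      on \<open>W\<close>; minimality then keeps all others, among them \<open>mu i\<close>,
      inside.\<close>
    define W where "W = V \<inter> (\<Inter>i\<in>I - J \<theta>1. mu i -` (- S) \<inter> V)"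
    have W: "open W" unfolding W_def
    proof (rule open_Int[OF V(1)], rule open_INT, rule finite_Diff[OF I(1)], rule ballI)
      fix i assume "i \<in> I - J \<theta>1"
      then show "open (mu i -` (- S) \<inter> V)"
        using continuous_on_open_vimage[OF V(1)] I(2) closed_subspace[OF S(1)] by blast
    qed
    have W1: "\<theta>1 \<in> W" using \<theta>1(1) by (auto simp: W_def J_def)
    have inS: "mu i \<theta> \<in> S" if \<theta>: "\<theta> \<in> W" for \<theta>
    proof -
      have "J \<theta> \<subseteq> J \<theta>1" using \<theta> unfolding W_def J_def by blast
      then have "J \<theta> = J \<theta>1" using \<theta>1(2) \<theta> finJ by (intro card_seteq) (auto simp: W_def)
      then show ?thesis using i by (auto simp: J_def)
    qed
    have iI: "i \<in> I" using i by (simp add: J_def)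
    obtain s where s: "inj_on (\<lambda>z. z \<bullet> s) S" by (rule inj_on_inner_line[OF S(1,2)])
    obtain c where c: "infinite {\<theta>\<in>W. mu i \<theta> \<bullet> s = c}"
    proof (rule infinite_fiber_real[of W "\<lambda>\<theta>. mu i \<theta> \<bullet> s"])
      show "continuous_on W (\<lambda>\<theta>. mu i \<theta> \<bullet> s)"
        by (intro continuous_intros continuous_on_subset[OF I(2)[OF iI]]) (auto simp: W_def)
    qed (use W W1 dim in auto)
    then obtain \<theta>' where \<theta>': "\<theta>' \<in> W" "mu i \<theta>' \<bullet> s = c"
      using infinite_imp_nonempty by blast
    have "{\<theta>\<in>W. mu i \<theta> \<bullet> s = c} \<subseteq> {\<theta>\<in>W. mu i \<theta> = mu i \<theta>'}"
      using \<theta>' inS s by (auto simp: inj_on_def)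
    with c fiber[of W i "mu i \<theta>'"] iI show False
      using finite_subset by (auto simp: W_def)
  qed
  moreover have "aff_dim P = 1" if "eigenvalue_branches P A lam" "lam k ` P \<subseteq> \<real>" for lam k
  proof (rule line[OF that(1) _ _ that(2)])
    have eq: "(\<real> :: complex set) = span {1}" by (auto simp: span_singleton Reals_def scaleR_conv_of_real)
    show "subspace (\<real> :: complex set)" unfolding eq by simp
    show "dim (\<real> :: complex set) = 1" unfolding eq by simp
  qed
  ultimately show ?thesis using aff by auto
qed

end
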